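(* Assume $\mathrm{cof}(\mathcal M)=\omega_1$. Then there is a compact Hausdorff space $X$ having the following properties: (1) $X$ has weight $w(X)=\omega_1$; (2) $X$ is uniform Eberlein compact; (3) $X$ is Rosenthal compact; (4) $X$ is first countable; (5) $X$ is hereditarily paracompact; (6) $X$ is not supercompact.
   Context: A topological space $X$ is supercompact if it has a subbase $\mathcal B$ of its topology such that each cover of $X$ by elements of $\mathcal B$ has a subcover consisting of at most two elements. A compact space is uniform Eberlein compact if it embeds into a Hilbert space endowed with the weak topology. A compact space is Rosenthal compact if it embeds into the space $B_1(P)\subseteq\mathbb R^P$ (with the topology of pointwise convergence) of functions of the first Baire class on some Polish space $P$. A space is hereditarily paracompact if each of its subspaces is paracompact. $\mathcal M$ is the ideal of meager subsets of the real line and $\mathrm{cof}(\mathcal M)$ is its cofinality, i.e. the smallest cardinality of a subfamily $\mathcal A\subseteq\mathcal M$ such that every element of $\mathcal M$ is contained in an element of $\mathcal A$. The weight $w(X)$ is the smallest cardinality of a base of the topology of $X$. *)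

theory Defs
  imports "HOL-Analysis.Analysis"
begin

unbundle cardinal_syntax

section \<open>Cardinal invariants\<close>

text \<open>
  The smallest cardinality of a member of the family \<open>\<F>\<close> is the cardinal \<open>\<kappa>\<close>. Cardinals are
  represented by well-order relations as in the library, so \<open>\<omega>\<^sub>1\<close> is \<open>cardSuc natLeq\<close>.
\<close>
definition least_cardinality :: "'a set set \<Rightarrow> 'k rel \<Rightarrow> bool" where
  "least_cardinality \<F> \<kappa> \<longleftrightarrow> (\<exists>A\<in>\<F>. card_of A =o \<kappa>) \<and> (\<forall>A\<in>\<F>. \<kappa> \<le>o card_of A)"

definition omega1 :: "nat set rel" where
  "omega1 = cardSuc natLeq"

definition nowhere_dense :: "'a::topological_space set \<Rightarrow> bool" where
  "nowhere_dense S \<longleftrightarrow> interior (closure S) = {}"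

definition meager :: "'a::topological_space set \<Rightarrow> bool" where
  "meager S \<longleftrightarrow> (\<exists>\<N>. countable \<N> \<and> (\<forall>N\<in>\<N>. nowhere_dense N) \<and> S = \<Union>\<N>)"

definition cof_meager_eq :: "'k rel \<Rightarrow> bool" where
  "cof_meager_eq \<kappa> \<longleftrightarrow>
     least_cardinality
       {\<A> :: real set set. (\<forall>A\<in>\<A>. meager A) \<and> (\<forall>M. meager M \<longrightarrow> (\<exists>A\<in>\<A>. M \<subseteq> A))} \<kappa>"

definition base_of :: "'a topology \<Rightarrow> 'a set set \<Rightarrow> bool" where
  "base_of X \<B> \<longleftrightarrow>
     (\<forall>V\<in>\<B>. openin X V) \<and> (\<forall>U x. openin X U \<and> x \<in> U \<longrightarrow> (\<exists>V\<in>\<B>. x \<in> V \<and> V \<subseteq> U))"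

definition weight_eq :: "'a topology \<Rightarrow> 'k rel \<Rightarrow> bool" where
  "weight_eq X \<kappa> \<longleftrightarrow> least_cardinality {\<B>. base_of X \<B>} \<kappa>"


section \<open>Supercompact and paracompact spaces\<close>

definition supercompact_space :: "'a topology \<Rightarrow> bool" where
  "supercompact_space X \<longleftrightarrow>
     (\<exists>\<B>. topology_generated_by \<B> = X \<and>
        (\<forall>\<C>. \<C> \<subseteq> \<B> \<and> \<Union>\<C> = topspace X \<longrightarrow>
           (\<exists>\<D>. \<D> \<subseteq> \<C> \<and> finite \<D> \<and> card \<D> \<le> 2 \<and> \<Union>\<D> = topspace X)))"

text \<open>No separation axiom is built in; below the notion is only used for Hausdorff spaces.\<close>
definition paracompact_space :: "'a topology \<Rightarrow> bool" where
  "paracompact_space X \<longleftrightarrow>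
     (\<forall>\<U>. (\<forall>U\<in>\<U>. openin X U) \<and> \<Union>\<U> = topspace X \<longrightarrow>
        (\<exists>\<V>. (\<forall>V\<in>\<V>. openin X V) \<and> \<Union>\<V> = topspace X \<and>
              (\<forall>V\<in>\<V>. \<exists>U\<in>\<U>. V \<subseteq> U) \<and> locally_finite_in X \<V>))"


section \<open>Rosenthal compact spaces\<close>

definition Polish_space :: "'a topology \<Rightarrow> bool" where
  "Polish_space P \<longleftrightarrow> completely_metrizable_space P \<and> separable_space P"

text \<open>Functions on \<open>P\<close> are represented by their extensional versions, as in \<open>product_topology\<close>.\<close>
definition Baire_one :: "'a topology \<Rightarrow> ('a \<Rightarrow> real) set" where
  "Baire_one P =
     {f \<in> topspace P \<rightarrow>\<^sub>E UNIV.
        \<exists>g :: nat \<Rightarrow> 'a \<Rightarrow> real. (\<forall>n. continuous_map P euclideanreal (g n)) \<and>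
          (\<forall>x\<in>topspace P. (\<lambda>n. g n x) \<longlonglongrightarrow> f x)}"

definition Baire_one_topology :: "'a topology \<Rightarrow> ('a \<Rightarrow> real) topology" where
  "Baire_one_topology P =
     subtopology (product_topology (\<lambda>_. euclideanreal) (topspace P)) (Baire_one P)"

text \<open>
  A Polish space has at most continuum many points, so it is no restriction to let its
  underlying set be a set of reals (with an arbitrary Polish topology, not the Euclidean one).
\<close>
definition Rosenthal_compact :: "'a topology \<Rightarrow> bool" where
  "Rosenthal_compact X \<longleftrightarrow> compact_space X \<and>
     (\<exists>P :: real topology. Polish_space P \<and> (\<exists>f. embedding_map X (Baire_one_topology P) f))"


section \<open>Hilbert spaces and uniform Eberlein compact spaces\<close>

text \<open>
  Hilbert spaces are rendered with explicit carriers, since one has to quantify over them.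
\<close>
record 'h hspace =
  vectors :: "'h set"
  vzero :: 'h
  vplus :: "'h \<Rightarrow> 'h \<Rightarrow> 'h"
  vscale :: "real \<Rightarrow> 'h \<Rightarrow> 'h"
  vinner :: "'h \<Rightarrow> 'h \<Rightarrow> real"

definition vnorm :: "'h hspace \<Rightarrow> 'h \<Rightarrow> real" where
  "vnorm H x = sqrt (vinner H x x)"

definition vdist :: "'h hspace \<Rightarrow> 'h \<Rightarrow> 'h \<Rightarrow> real" where
  "vdist H x y = vnorm H (vplus H x (vscale H (-1) y))"

locale real_hilbert_space =
  fixes H :: "'h hspace"
  assumes zero_closed: "vzero H \<in> vectors H"
    and plus_closed: "\<lbrakk>x \<in> vectors H; y \<in> vectors H\<rbrakk> \<Longrightarrow> vplus H x y \<in> vectors H"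
    and scale_closed: "x \<in> vectors H \<Longrightarrow> vscale H a x \<in> vectors H"
    and plus_assoc: "\<lbrakk>x \<in> vectors H; y \<in> vectors H; z \<in> vectors H\<rbrakk>
      \<Longrightarrow> vplus H (vplus H x y) z = vplus H x (vplus H y z)"
    and plus_commute: "\<lbrakk>x \<in> vectors H; y \<in> vectors H\<rbrakk> \<Longrightarrow> vplus H x y = vplus H y x"
    and plus_zero: "x \<in> vectors H \<Longrightarrow> vplus H x (vzero H) = x"
    and plus_inverse: "x \<in> vectors H \<Longrightarrow> \<exists>y\<in>vectors H. vplus H x y = vzero H"
    and scale_plus: "\<lbrakk>x \<in> vectors H; y \<in> vectors H\<rbrakk>
      \<Longrightarrow> vscale H a (vplus H x y) = vplus H (vscale H a x) (vscale H a y)"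
    and plus_scale: "x \<in> vectors H
      \<Longrightarrow> vscale H (a + b) x = vplus H (vscale H a x) (vscale H b x)"
    and scale_scale: "x \<in> vectors H \<Longrightarrow> vscale H a (vscale H b x) = vscale H (a * b) x"
    and scale_one: "x \<in> vectors H \<Longrightarrow> vscale H 1 x = x"
    and inner_commute: "\<lbrakk>x \<in> vectors H; y \<in> vectors H\<rbrakk> \<Longrightarrow> vinner H x y = vinner H y x"
    and inner_plus: "\<lbrakk>x \<in> vectors H; y \<in> vectors H; z \<in> vectors H\<rbrakk>
      \<Longrightarrow> vinner H (vplus H x y) z = vinner H x z + vinner H y z"
    and inner_scale: "\<lbrakk>x \<in> vectors H; y \<in> vectors H\<rbrakk>
      \<Longrightarrow> vinner H (vscale H a x) y = a * vinner H x y"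
    and inner_nonneg: "x \<in> vectors H \<Longrightarrow> 0 \<le> vinner H x x"
    and inner_definite: "\<lbrakk>x \<in> vectors H; vinner H x x = 0\<rbrakk> \<Longrightarrow> x = vzero H"
    and complete: "Metric_space.mcomplete (vectors H) (vdist H)"

definition continuous_functional :: "'h hspace \<Rightarrow> ('h \<Rightarrow> real) \<Rightarrow> bool" where
  "continuous_functional H \<phi> \<longleftrightarrow>
     (\<forall>x\<in>vectors H. \<forall>y\<in>vectors H. \<phi> (vplus H x y) = \<phi> x + \<phi> y) \<and>
     (\<forall>a. \<forall>x\<in>vectors H. \<phi> (vscale H a x) = a * \<phi> x) \<and>
     (\<exists>K. \<forall>x\<in>vectors H. \<bar>\<phi> x\<bar> \<le> K * vnorm H x)"

definition weak_topology :: "'h hspace \<Rightarrow> 'h topology" where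
  "weak_topology H =
     topology_generated_by
       {{x \<in> vectors H. \<phi> x \<in> U} | \<phi> U. continuous_functional H \<phi> \<and> open U}"

text \<open>
  Taking the underlying set of the Hilbert space inside the type \<open>'a \<Rightarrow> real\<close> is no restriction:
  if \<open>f\<close> embeds \<open>X\<close> into a Hilbert space, one may replace that space by the closed linear span of
  the image of \<open>f\<close> (with the same induced weak topology), and a vector \<open>h\<close> of the closed span is
  determined by the function \<open>x \<mapsto> \<langle>h, f x\<rangle>\<close> on \<open>X\<close>.
\<close>
definition uniform_Eberlein_compact :: "'a topology \<Rightarrow> bool" where
  "uniform_Eberlein_compact X \<longleftrightarrow> compact_space X \<and>
     (\<exists>H :: ('a \<Rightarrow> real) hspace. real_hilbert_space H \<and>
        (\<exists>f. embedding_map X (weak_topology H) f))"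

end

theory Submission
  imports Defs
begin

text \<open>
  The set \<open>L\<close> is a Luzin set, which exists since \<open>cof(M) = \<omega>\<^sub>1\<close>: an uncountable set of size
  \<open>\<omega>\<^sub>1\<close> that meets each meager set in a countable set. The space is the closed subspace
  \<open>[0,2] \<times> {\<infinity>} \<union> {(y, x). x \<in> L \<and> y \<in> F\<^sub>x}\<close> of \<open>[0,2] \<times> \<alpha>L\<close>, where
  \<open>\<alpha>L\<close> is the one-point compactification of the discrete space \<open>L\<close> and \<open>F\<^sub>x = x + G\<^sub>x\<close>
  for a sequence \<open>G\<^sub>x\<close> of rationals that decreases to \<open>0\<close>, depends on \<open>x\<close> and is as generic as
  \<open>x\<close>. Since each point lies in countably many \<open>F\<^sub>x\<close>, the space is first countable.

  Suppose that it is supercompact. For each \<open>n\<close> take a finite cover by intersections of closed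
  subbasic sets whose first projections have diameter less than \<open>2\<^sup>-\<^sup>n\<close>. For all but countably
  many \<open>x\<close> the part of each such \<open>Q\<close> over \<open>x\<close> projects into its part \<open>Q\<^sub>\<infinity>\<close> over
  \<open>\<infinity>\<close>. Choose \<open>x\<close> generic and \<open>Q\<close> containing \<open>(x, x)\<close>, and put \<open>q = max Q\<^sub>\<infinity>\<close>.
  By genericity there is \<open>e \<in> F\<^sub>x\<close> so close to \<open>q\<close> on the right that each \<open>R\<close> of a much finer
  cover with \<open>(e, x) \<in> R\<close> contains \<open>(q, \<infinity>)\<close>, while \<open>F\<^sub>x\<close> has no points close to
  \<open>q\<close> on the left. The fibre over \<open>x\<close> is a finite union of intersections of closed subbasic
  sets, and one of them contains both \<open>(x, x)\<close> and \<open>(e, x)\<close>. It meets \<open>Q\<close> and \<open>R\<close>, and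
  these meet in \<open>(q, \<infinity>)\<close>, but the three sets have no common point.
\<close>

subsection \<open>Cardinals and category\<close>

lemma countable_iff_ordLeq_natLeq: "countable A \<longleftrightarrow> |A| \<le>o natLeq"
proof -
  have "countable A \<longleftrightarrow> |A| \<le>o |UNIV :: nat set|"
    unfolding countable_def card_of_ordLeq[symmetric] by auto
  also have "\<dots> \<longleftrightarrow> |A| \<le>o natLeq"
    using card_of_nat ordIso_symmetric ordLeq_ordIso_trans by blast
  finally show ?thesis .
qed

lemma Card_order_omega1: "Card_order omega1"
  unfolding omega1_def by (simp add: cardSuc_Card_order natLeq_Card_order)

lemma infinite_Field_omega1: "infinite (Field omega1)"
  unfolding omega1_def by (metis Field_natLeq cardSuc_finite infinite_UNIV_nat natLeq_Card_order)

lemma countable_iff_ordLess_omega1: "countable A \<longleftrightarrow> |A| <o omega1"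
  unfolding countable_iff_ordLeq_natLeq omega1_def
  by (metis cardSuc_ordLeq_ordLess card_of_Card_order natLeq_Card_order)

lemma uncountable_iff_omega1_ordLeq: "uncountable A \<longleftrightarrow> omega1 \<le>o |A|"
  unfolding countable_iff_ordLess_omega1
  using Card_order_omega1 card_of_Well_order not_ordLess_iff_ordLeq card_order_on_def by blast

section \<open>Meager sets of reals\<close>

lemma nowhere_dense_singleton: "nowhere_dense {a :: real}"
  by (simp add: nowhere_dense_def)

lemma meager_countable:
  assumes "countable (A :: real set)"
  shows "meager A"
  unfolding meager_def
  by (rule exI[of _ "(\<lambda>a. {a}) ` A"]) (use assms in \<open>auto simp: nowhere_dense_singleton\<close>)

lemma nowhere_dense_imp_meager: "nowhere_dense A \<Longrightarrow> meager A"
  unfolding meager_def by (rule exI[of _ "{A}"]) auto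

lemma meager_UN:
  assumes "countable I" "\<And>i. i \<in> I \<Longrightarrow> meager (A i)"
  shows "meager (\<Union>i\<in>I. A i)"
proof -
  from assms(2) have "\<forall>i\<in>I. \<exists>\<N>. countable \<N> \<and> (\<forall>N\<in>\<N>. nowhere_dense N) \<and> A i = \<Union>\<N>"
    unfolding meager_def by blast
  then obtain \<N> where "\<And>i. i \<in> I \<Longrightarrow> countable (\<N> i) \<and> (\<forall>N\<in>\<N> i. nowhere_dense N) \<and> A i = \<Union>(\<N> i)"
    by metis
  then show ?thesis
    unfolding meager_def using assms(1) by (intro exI[of _ "\<Union>i\<in>I. \<N> i"]) auto
qed

lemma meager_interior_empty:
  assumes "meager (M :: real set)"
  shows "interior M = {}"
proof -
  obtain \<N> where \<N>: "countable \<N>" "\<And>N. N \<in> \<N> \<Longrightarrow> interior (closure N) = {}" "M = \<Union>\<N>"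
    using assms unfolding meager_def nowhere_dense_def by blast
  have "euclideanreal interior_of \<Union>(closure ` \<N>) = {}"
    by (rule Baire_category_alt)
       (use \<N> in \<open>auto simp: completely_metrizable_space_euclidean\<close>)
  moreover have "M \<subseteq> \<Union>(closure ` \<N>)"
    using \<N>(3) closure_subset by fastforce
  ultimately show ?thesis
    by (metis euclidean_interior_of interior_mono subset_empty)
qed

text \<open>A cofinal family of size \<open>omega1\<close> is well-ordered with countable initial
  segments, so by Baire category a point of \<open>U\<close> can be chosen outside each member and
  all its predecessors. A meager set lies in some member, and only the points chosen for the
  predecessors of that member can hit it.\<close>

lemma Luzin_set:
  assumes "cof_meager_eq omega1" and "open U" "U \<noteq> {}"
  shows "\<exists>L :: real set. L \<subseteq> U \<and> uncountable L \<and> |L| \<le>o omega1 \<and>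
    (\<forall>M. meager M \<longrightarrow> countable (L \<inter> M))"
proof -
  obtain \<A> :: "real set set" where mg: "\<And>A. A \<in> \<A> \<Longrightarrow> meager A"
      and cof: "\<And>M. meager M \<Longrightarrow> \<exists>A\<in>\<A>. M \<subseteq> A" and card: "|\<A>| =o omega1"
    using assms(1) unfolding cof_meager_eq_def least_cardinality_def by blast
  let ?r = "|\<A>|"
  have Field: "Field ?r = \<A>"
    by (rule Field_card_of)
  have ctb: "countable (underS ?r A)" if "A \<in> \<A>" for A
    unfolding countable_iff_ordLess_omega1
    using card_of_underS[OF card_of_Card_order, of A \<A>] that card
    by (metis Field ordLess_ordIso_trans)
  have "\<exists>x. x \<in> U \<and> (\<forall>B\<in>insert A (underS ?r A). x \<notin> B)" if "A \<in> \<A>" for A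
  proof (rule ccontr)
    assume "\<not> ?thesis"
    then have "U \<subseteq> (\<Union>B\<in>insert A (underS ?r A). B)"
      by auto
    moreover have "meager (\<Union>B\<in>insert A (underS ?r A). B)"
    proof (rule meager_UN)
      show "countable (insert A (underS ?r A))"
        using ctb[OF that] by simp
      show "meager B" if "B \<in> insert A (underS ?r A)" for B
        using that mg \<open>A \<in> \<A>\<close> underS_Field[of B ?r A] Field by auto
    qed
    ultimately show False
      using assms(2,3) meager_interior_empty interior_maximal by blast
  qed
  then obtain x where x: "\<And>A. A \<in> \<A> \<Longrightarrow> x A \<in> U"
      "\<And>A B. A \<in> \<A> \<Longrightarrow> B \<in> insert A (underS ?r A) \<Longrightarrow> x A \<notin> B"
    by metis
  have below: "A \<in> underS ?r B" if "A \<in> \<A>" "B \<in> \<A>" "x A \<in> B" for A B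
  proof -
    have "A \<noteq> B" "B \<notin> underS ?r A"
      using x(2) that by blast+
    moreover have "Total ?r"
      using card_of_Well_order[of \<A>] unfolding well_order_on_def linear_order_on_def by simp
    ultimately show ?thesis
      using that Field unfolding underS_def total_on_def by blast
  qed
  \<comment> \<open>Indices are counted rather than points, since \<open>x\<close> need not be
    injective. The set of points is then uncountable: otherwise it would be meager itself and pull
    back to all of \<open>\<A>\<close>.\<close>
  have sub: "countable {A \<in> \<A>. x A \<in> M}" if "meager M" for M
  proof -
    obtain B where "B \<in> \<A>" "M \<subseteq> B"
      using cof[OF \<open>meager M\<close>] by blast
    then have "{A \<in> \<A>. x A \<in> M} \<subseteq> underS ?r B"
      using below by blast
    then show ?thesis
      using ctb[OF \<open>B \<in> \<A>\<close>] countable_subset by blast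
  qed
  show ?thesis
  proof (intro exI[of _ "x ` \<A>"] conjI allI impI)
    show "x ` \<A> \<subseteq> U"
      using x(1) by blast
    show "uncountable (x ` \<A>)"
    proof
      assume "countable (x ` \<A>)"
      then have "countable {A \<in> \<A>. x A \<in> x ` \<A>}"
        using sub meager_countable by blast
      moreover have "{A \<in> \<A>. x A \<in> x ` \<A>} = \<A>"
        by blast
      ultimately show False
        using card unfolding countable_iff_ordLess_omega1 by (simp add: not_ordLess_ordIso)
    qed
    show "|x ` \<A>| \<le>o omega1"
      using card_of_image card ordLeq_ordIso_trans by blast
    show "countable (x ` \<A> \<inter> M)" if "meager M" for M
    proof -
      have "x ` \<A> \<inter> M = x ` {A \<in> \<A>. x A \<in> M}"
        by blast
      then show ?thesis
        using sub[OF that] by simp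
    qed
  qed
qed

subsection \<open>A scheme of intervals\<close>

text \<open>The newest letter stands at the head of a word. \<open>lft s\<close> and
  \<open>wid s\<close> are the left end and the length of an open interval, which is split into
  dyadic pieces that shrink to its left end; a large next letter therefore means closeness to
  \<open>lft s\<close>.\<close>

primrec wid :: "nat list \<Rightarrow> real" where
  "wid [] = 1"
| "wid (i # s) = wid s / 2 ^ Suc i"

primrec lft :: "nat list \<Rightarrow> real" where
  "lft [] = 0"
| "lft (i # s) = lft s + wid s / 2 ^ Suc i"

definition cyl :: "nat list \<Rightarrow> real set" where
  "cyl s = {lft s <..< lft s + wid s}"

lemma wid_pos: "wid s > 0"
  by (induction s) auto

lemma wid_le: "wid s \<le> 1 / 2 ^ length s"
proof (induction s)
  case (Cons i s)
  have "wid s / 2 ^ Suc i \<le> wid s / 2"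
    using wid_pos[of s] by (intro divide_left_mono) (auto simp: one_le_power)
  also have "\<dots> \<le> (1 / 2 ^ length s) / 2"
    using Cons by (intro divide_right_mono) auto
  finally  show ?case
    by simp
qed simp

lemma open_cyl: "open (cyl s)"
  by (simp add: cyl_def)

lemma cyl_nonempty: "cyl s \<noteq> {}"
  using wid_pos[of s] by (simp add: cyl_def)

lemma cyl_Cons: "cyl (i # s) = {lft s + wid s / 2 ^ Suc i <..< lft s + wid s / 2 ^ i}"
proof -
  have "wid s / 2 ^ Suc i + wid s / 2 ^ Suc i = wid s / 2 ^ i"
    by simp
  then show ?thesis
    by (simp only: cyl_def lft.simps wid.simps add.assoc)
qed

lemma cyl_Cons_subset: "cyl (i # s) \<subseteq> cyl s"
proof -
  have "wid s / 2 ^ i \<le> wid s" "wid s / 2 ^ Suc i > 0"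
    using wid_pos[of s] by (auto simp: field_simps one_le_power)
  then show ?thesis
    unfolding cyl_Cons unfolding cyl_def by auto
qed

lemma cyl_append_subset: "cyl (t @ s) \<subseteq> cyl s"
proof (induction t)
  case (Cons i t)
  then show ?case
    using cyl_Cons_subset[of i "t @ s"] by auto
qed simp

lemma cyl_Cons_eq:
  assumes "x \<in> cyl (i # s)" "x \<in> cyl (j # s)"
  shows "i = j"
proof -
  have False if "i < j" "x \<in> cyl (i # s)" "x \<in> cyl (j # s)" for i j
  proof -
    have "wid s / 2 ^ j \<le> wid s / 2 ^ Suc i"
      using that(1) wid_pos[of s] by (intro divide_left_mono power_increasing) auto
    then show False
      using that(2,3) unfolding cyl_Cons by auto
  qed
  then show ?thesis
    using assms by (metis linorder_neqE_nat)
qed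

lemma cyl_unique:
  assumes "length s = length t" "x \<in> cyl s" "x \<in> cyl t"
  shows "s = t"
  using assms
proof (induction s t rule: list_induct2)
  case (Cons i s j t)
  then have "s = t"
    using cyl_Cons_subset by blast
  with Cons show ?case
    using cyl_Cons_eq by blast
qed simp

lemma cyl_drop: "x \<in> cyl s \<Longrightarrow> x \<in> cyl (drop k s)"
  using cyl_append_subset[of "take k s" "drop k s"] by auto

lemma cyl_eq_drop:
  assumes "x \<in> cyl s" "x \<in> cyl t" "length t \<le> length s"
  shows "t = drop (length s - length t) s"
  using assms by (intro cyl_unique[of _ _ x] cyl_drop) auto

text \<open>Outside the countable set \<open>N\<close> of endpoints, every point of the unit
  interval lies in an interval of each level, and the widths tend to \<open>0\<close>. By Baire
  category \<open>J\<close> has a point outside \<open>N\<close>.\<close>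

lemma ex_cyl_subset:
  assumes "open J" "J \<subseteq> {0<..<1}" "J \<noteq> {}"
  shows "\<exists>s. cyl s \<subseteq> J"
proof -
  define N where "N = range (\<lambda>(s, i). lft s + wid s / 2 ^ i)"
  have "countable N"
    unfolding N_def by simp
  then have "interior N = {}"
    by (intro meager_interior_empty meager_countable)
  then have "\<not> J \<subseteq> N"
    using assms(1,3) interior_maximal by blast
  then obtain x where x: "x \<in> J" "x \<notin> N"
    by blast
  have step: "\<exists>i. x \<in> cyl (i # s)" if "x \<in> cyl s" for s
  proof -
    let ?v = "(x - lft s) / wid s"
    have v: "0 < ?v" "?v < 1"
      using that wid_pos[of s] by (auto simp: cyl_def field_simps)
    \<comment> \<open>The next letter is one less than the first exponent with
      \<open>1 / 2 ^ i < ?v\<close>; this exponent is positive since \<open>?v < 1\<close>.\<close>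
    define i where "i = (LEAST i. 1 / 2 ^ i < ?v)"
    obtain i0 where "(1/2) ^ i0 < ?v"
      using real_arch_pow_inv[OF v(1), of "1/2"] by auto
    then have i0: "1 / 2 ^ i0 < ?v"
      by (simp add: power_one_over)
    have i: "1 / 2 ^ i < ?v"
      unfolding i_def by (rule LeastI[where P = "\<lambda>i. 1 / 2 ^ i < ?v", OF i0])
    then have "i \<noteq> 0"
      using v by (intro notI) simp
    then obtain j where j: "i = Suc j"
      using not0_implies_Suc by blast
    then have "\<not> 1 / 2 ^ j < ?v"
      unfolding i_def using not_less_Least by (metis lessI)
    moreover have "?v \<noteq> 1 / 2 ^ j"
    proof
      assume "?v = 1 / 2 ^ j"
      then have "x = lft s + wid s / 2 ^ j"
        using wid_pos[of s] by (simp add: field_simps)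
      then show False
        using x(2) unfolding N_def by auto
    qed
    ultimately have "?v < 1 / 2 ^ j"
      by simp
    moreover have "1 / 2 ^ Suc j < ?v"
      using i j by simp
    ultimately have "x \<in> cyl (j # s)"
      unfolding cyl_Cons using wid_pos[of s] by (simp add: field_simps)
    then show ?thesis ..
  qed
  have ex: "\<exists>s. length s = k \<and> x \<in> cyl s" for k
  proof (induction k)
    case 0
    then show ?case
      using x(1) assms(2) by (auto simp: cyl_def)
  next
    case (Suc k)
    then show ?case
      using step by (metis length_Cons)
  qed
  obtain e where e: "e > 0" "ball x e \<subseteq> J"
    using assms(1) x(1) open_contains_ball by blast
  obtain k where "(1/2) ^ k < e"
    using real_arch_pow_inv[OF e(1), of "1/2"] by auto
  then have k: "1 / 2 ^ k < e"
    by (simp add: power_one_over)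
  obtain s where s: "length s = k" "x \<in> cyl s"
    using ex by blast
  have "cyl s \<subseteq> ball x e"
    using s(2) wid_le[of s] s(1) k by (auto simp: cyl_def dist_real_def)
  then show ?thesis
    using e(2) by blast
qed

subsection \<open>The sets attached to the points of the Luzin set\<close>

text \<open>The natural number in the decoded pair makes every finite set of rationals the label of
  arbitrarily large letters, so a label can be prescribed together with closeness to the left
  end.\<close>

definition label :: "nat \<Rightarrow> real set" where
  "label i = of_rat ` set (fst (from_nat i :: rat list \<times> nat))"

lemma finite_label: "finite (label i)"
  by (simp add: label_def)

lemma label_Rats: "label i \<subseteq> \<rat>"
  by (auto simp: label_def)

lemma ex_label_eq:
  assumes "finite D" "D \<subseteq> \<rat>"
  obtains i where "i \<ge> k" "label i = D"
proof -
  obtain C where C: "D = of_rat ` C" "finite C"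
    using assms by (metis Rats_def finite_subset_image)
  obtain ds where ds: "set ds = C"
    using finite_list C(2) by blast
  let ?f = "\<lambda>j :: nat. to_nat (ds, j)"
  have "inj ?f"
    by (auto simp: inj_on_def)
  then have "infinite (range ?f)"
    using finite_imageD infinite_UNIV_nat by blast
  then have "\<exists>n>k. n \<in> range ?f"
    using infinite_nat_iff_unbounded by blast
  then obtain j where "?f j > k"
    by blast
  moreover have "label (?f j) = D"
    by (simp add: label_def ds C(1))
  ultimately show thesis
    using that less_imp_le by blast
qed

text \<open>The cutoff at \<open>1 / 2 ^ length s\<close> forces the shifts of longer and longer
  words to \<open>0\<close>.\<close>

primrec shifts :: "nat list \<Rightarrow> real set" where
  "shifts [] = {}"
| "shifts (i # s) = label i \<inter> {0 <..< 1 / 2 ^ length s}"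

text \<open>These are the sets \<open>F\<^sub>x\<close>. The intervals around \<open>x\<close> spell
  out a sequence of labels, so that prescribing finitely many letters of \<open>x\<close> prescribes
  finitely many blocks of its shifts.\<close>

definition fib :: "real \<Rightarrow> real set" where
  "fib x = insert x {x + h |h s. x \<in> cyl s \<and> h \<in> shifts s}"

lemma finite_shifts: "finite (shifts s)"
  by (cases s) (auto simp: finite_label)

lemma shifts_Rats: "shifts s \<subseteq> \<rat>"
  by (cases s) (use label_Rats in auto)

lemma shifts_pos: "h \<in> shifts s \<Longrightarrow> h > 0"
  by (cases s) auto

lemma shifts_less: "h \<in> shifts s \<Longrightarrow> k < length s \<Longrightarrow> h < 1 / 2 ^ k"
proof (cases s)
  case (Cons i t)
  assume "h \<in> shifts s" "k < length s"
  then have "h < 1 / 2 ^ length t" "k \<le> length t"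
    using Cons by auto
  moreover have "1 / 2 ^ length t \<le> (1 :: real) / 2 ^ k"
    using \<open>k \<le> length t\<close> by (intro divide_left_mono power_increasing) auto
  ultimately show ?thesis
    by linarith
qed simp

lemma fib_self: "x \<in> fib x"
  by (simp add: fib_def)

lemma fib_ge: "y \<in> fib x \<Longrightarrow> x \<le> y"
  by (auto simp: fib_def dest: shifts_pos)

lemma fib_less: "y \<in> fib x \<Longrightarrow> y < x + 1"
proof -
  assume "y \<in> fib x"
  then consider "y = x" | h s where "y = x + h" "h \<in> shifts s"
    unfolding fib_def by blast
  then show ?thesis
  proof cases
    case 2
    then show ?thesis
      using shifts_less[of h s 0] by (cases s) auto
  qed simp
qed

lemma fib_Rats: "y \<in> fib x \<Longrightarrow> y - x \<in> \<rat>"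
  by (auto simp: fib_def dest: subsetD[OF shifts_Rats])

text \<open>A shift of size at least \<open>e\<close> comes from a word of bounded length,
  \<open>x\<close> lies in at most one interval of each length, and each word has finitely many
  shifts.\<close>

lemma finite_fib_ge:
  assumes "e > 0"
  shows "finite (fib x \<inter> {x + e..})"
proof -
  obtain k where "(1/2) ^ k < e"
    using real_arch_pow_inv[OF assms, of "1/2"] by auto
  then have k: "1 / 2 ^ k < e"
    by (simp add: power_one_over)
  let ?S = "{s. x \<in> cyl s \<and> length s \<le> k}"
  have "inj_on length ?S"
    using cyl_unique by (auto intro: inj_onI)
  moreover have "finite (length ` ?S)"
    by (rule finite_subset[of _ "{..k}"]) auto
  ultimately have "finite ?S"
    using finite_imageD by blast
  then have "finite (\<Union>s\<in>?S. (\<lambda>h. x + h) ` shifts s)"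
    by (simp add: finite_shifts)
  moreover have "fib x \<inter> {x + e..} \<subseteq> (\<Union>s\<in>?S. (\<lambda>h. x + h) ` shifts s)"
  proof
    fix y assume y: "y \<in> fib x \<inter> {x + e..}"
    then have "y \<noteq> x"
      using assms by auto
    then obtain h s where hs: "y = x + h" "x \<in> cyl s" "h \<in> shifts s"
      using y unfolding fib_def by blast
    then have "e \<le> h"
      using y by simp
    then have "length s \<le> k"
      using shifts_less[OF hs(3), of k] k by (metis linorder_not_less order_less_trans)
    then show "y \<in> (\<Union>s\<in>?S. (\<lambda>h. x + h) ` shifts s)"
      using hs by blast
  qed
  ultimately show ?thesis
    using finite_subset by blast
qed

text \<open>The set has no points to the left of \<open>x\<close>, and beyond any bound greater than
  \<open>x\<close> it is finite.\<close>

lemma closed_fib: "closed (fib x)"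
proof -
  have "open (- fib x)"
  proof (subst open_subopen, intro ballI)
    fix y assume y: "y \<in> - fib x"
    show "\<exists>T. open T \<and> y \<in> T \<and> T \<subseteq> - fib x"
    proof (cases "y < x")
      case True
      then show ?thesis
        using fib_ge by (intro exI[of _ "{..<x}"]) force
    next
      case False
      with y have "y > x"
        using fib_self[of x] by (metis Compl_iff linorder_less_linear)
      let ?T = "{x + (y - x) / 2<..} - fib x \<inter> {x + (y - x) / 2..}"
      have "open ?T"
        using \<open>y > x\<close> by (intro open_Diff finite_imp_closed finite_fib_ge) auto
      moreover have "y \<in> ?T" "?T \<subseteq> - fib x"
        using y \<open>y > x\<close> by (auto simp: field_simps)
      ultimately show ?thesis
        by blast
    qed
  qed
  then show ?thesis
    by (simp add: closed_def)
qed

subsection \<open>Genericity\<close>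

text \<open>
  Below \<open>P n\<close> is the set of the numbers \<open>max Q\<^sub>\<infinity>\<close> for \<open>Q\<close> in the \<open>n\<close>-th cover, and
  \<open>\<delta> q m\<close> says how close to \<open>q\<close> a point has to be for the members of the \<open>m\<close>-th cover.
\<close>
definition tuned :: "(nat \<Rightarrow> real set) \<Rightarrow> (real \<Rightarrow> nat \<Rightarrow> real) \<Rightarrow> nat \<Rightarrow> real \<Rightarrow> bool" where
  "tuned P \<delta> k x \<longleftrightarrow> (\<exists>n\<ge>k. \<forall>q\<in>P n. x < q \<and> q < x + 1 / 2 ^ n \<longrightarrow>
     (\<exists>m\<ge>k. fib x \<inter> {q - 1 / 2 ^ m..q} = {} \<and> fib x \<inter> {q <..< q + \<delta> q m} \<noteq> {}))"

lemma ex_power_less_finite: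
  assumes "finite V" "\<And>v. v \<in> V \<Longrightarrow> v > 0"
  shows "\<exists>m\<ge>k :: nat. \<forall>v\<in>V. 1 / 2 ^ m < (v :: real)"
proof -
  have "eventually (\<lambda>m. \<forall>v\<in>V. 1 / 2 ^ m < v) sequentially"
  proof (subst eventually_ball_finite_distrib[OF assms(1)], intro ballI)
    fix v assume "v \<in> V"
    have "(\<lambda>m. (1/2) ^ m) \<longlonglongrightarrow> (0 :: real)"
      by (rule LIMSEQ_realpow_zero) auto
    then show "eventually (\<lambda>m. 1 / 2 ^ m < v) sequentially"
      using order_tendstoD(2) assms(2)[OF \<open>v \<in> V\<close>] by (fastforce simp: power_one_over)
  qed
  then obtain m0 where "\<And>m. m \<ge> m0 \<Longrightarrow> \<forall>v\<in>V. 1 / 2 ^ m < v"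
    unfolding eventually_sequentially by blast
  then show ?thesis
    by (intro exI[of _ "max k m0"]) simp
qed

text \<open>
  The points \<open>x\<close> of \<open>cyl t\<close> lie just to the right of \<open>lft s\<close>, so the shifts can be chosen
  for \<open>lft s\<close> in place of \<open>x\<close>. If a point \<open>lft s + h\<close> given by an earlier shift hits some
  \<open>q\<close>, then \<open>x + h\<close> is harmless since it is to the right of \<open>q\<close>.
\<close>
lemma ex_cyl_tuned:
  assumes P: "\<And>n. finite (P n)" and \<delta>: "\<And>q m. \<delta> q m > 0"
  shows "\<exists>t. cyl t \<subseteq> cyl s \<and> (\<forall>x\<in>cyl t. tuned P \<delta> k x)"
proof -
  define l where "l = lft s"
  \<comment> \<open>The margin \<open>length s + 2\<close> keeps the new shifts \<open>h q\<close>
    below the cutoff \<open>1 / 2 ^ length s\<close> for each \<open>q\<close> within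
    \<open>1 / 2 ^ n\<close> of \<open>x\<close>.\<close>
  define n where "n = max k (length s + 2)"
  \<comment> \<open>The shifts already fixed by \<open>s\<close> and its suffixes, with
    \<open>0\<close> standing for the point \<open>x\<close> itself.\<close>
  define H where "H = insert 0 (\<Union>j\<in>{..length s}. shifts (drop j s))"
  \<comment> \<open>Thirds of the nonzero distances: with \<open>1 / 2 ^ m\<close> below all of
    them, the error from replacing \<open>x\<close> by \<open>l\<close> and the error in the choice
    of \<open>h\<close> still leave a gap larger than \<open>1 / 2 ^ m\<close>.\<close>
  define V where "V = (\<lambda>(h, q). \<bar>l + h - q\<bar> / 3) ` (H \<times> P n) \<union> (\<lambda>(q', q). \<bar>q' - q\<bar> / 3) ` (P n \<times> P n) - {0}"
  have "finite H"
    unfolding H_def using finite_shifts by auto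
  then have "finite V"
    unfolding V_def using P by auto
  moreover have "v > 0" if "v \<in> V" for v
    using that unfolding V_def by auto
  ultimately obtain m where mk: "m \<ge> max k (length s + 2)" and V: "\<And>v. v \<in> V \<Longrightarrow> 1 / 2 ^ m < v"
    using ex_power_less_finite[of V "max k (length s + 2)"] by blast
  then have m: "m \<ge> length s + 2" "\<And>v. v \<in> V \<Longrightarrow> 1 / 2 ^ m < v"
    by simp_all
  have mH: "l + h = q \<or> \<bar>l + h - q\<bar> > 3 * (1 / 2 ^ m)" if "h \<in> H" "q \<in> P n" for h q
  proof (cases "l + h = q")
    case False
    then have "\<bar>l + h - q\<bar> / 3 \<in> V"
      unfolding V_def using that by auto
    then show ?thesis
      using m(2) by fastforce
  qed simp
  have mP: "q' = q \<or> \<bar>q' - q\<bar> > 3 * (1 / 2 ^ m)" if "q' \<in> P n" "q \<in> P n" for q q'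
  proof (cases "q' = q")
    case False
    then have "\<bar>q' - q\<bar> / 3 \<in> V"
      unfolding V_def using that by auto
    then show ?thesis
      using m(2) by fastforce
  qed simp
  \<comment> \<open>Both \<open>x - l\<close> and \<open>h q - (q - l)\<close> will be below
    \<open>\<epsilon> q\<close>, so \<open>x + h q\<close> lies within \<open>\<delta> q m\<close>
    to the right of \<open>q\<close>.\<close>
  define \<epsilon> where "\<epsilon> q = min (\<delta> q m) (1 / 2 ^ m) / 2" for q
  have \<epsilon>: "\<epsilon> q > 0" "2 * \<epsilon> q \<le> \<delta> q m" "2 * \<epsilon> q \<le> 1 / 2 ^ m" for q
    using \<delta>[of q m] by (auto simp: \<epsilon>_def)
  have "\<exists>h\<in>\<rat>. q - l < h \<and> h < q - l + \<epsilon> q" for q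
    using Rats_dense_in_real[of "q - l" "q - l + \<epsilon> q"] \<epsilon>(1)[of q] by auto
  then obtain h where h: "\<And>q. h q \<in> \<rat>" "\<And>q. q - l < h q" "\<And>q. h q < q - l + \<epsilon> q"
    by metis
  have "finite (insert (1 / 2 ^ max m n) (\<epsilon> ` P n))" "\<And>v. v \<in> insert (1 / 2 ^ max m n) (\<epsilon> ` P n) \<Longrightarrow> v > 0"
    using P \<epsilon>(1) by auto
  then obtain i0 :: nat where i0: "\<And>v. v \<in> insert (1 / 2 ^ max m n) (\<epsilon> ` P n) \<Longrightarrow> 1 / 2 ^ i0 < v"
    using ex_power_less_finite[of _ 0] by meson
  \<comment> \<open>The label supplies the chosen rationals \<open>h q\<close>, and the size of the
    letter puts its interval close enough to \<open>l\<close>.\<close>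
  obtain i where i: "i \<ge> i0" "label i = h ` P n"
    using ex_label_eq[of "h ` P n" i0] P h(1) by blast
  obtain z where z: "label z = {}"
    using ex_label_eq[of "{}" 0] by blast
  \<comment> \<open>The \<open>m\<close> letters with empty label push every later shift below
    \<open>1 / 2 ^ m\<close>.\<close>
  define t where "t = replicate m z @ i # s"
  have near: "l < x" "x - l < 1 / 2 ^ m" "x - l < 1 / 2 ^ n" "\<And>q. q \<in> P n \<Longrightarrow> x - l < \<epsilon> q"
    if "x \<in> cyl (i # s)" for x
  proof -
    have "wid s / 2 ^ i \<le> 1 / 2 ^ i"
      using wid_le[of s] order_trans[OF wid_le[of s], of 1] by (simp add: divide_right_mono)
    also have "\<dots> \<le> 1 / 2 ^ i0"
      using i(1) by (intro divide_left_mono power_increasing) auto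
    finally have "x < l + 1 / 2 ^ i0"
      using that unfolding cyl_Cons l_def by auto
    moreover have "(1 :: real) / 2 ^ max m n \<le> 1 / 2 ^ m" "(1 :: real) / 2 ^ max m n \<le> 1 / 2 ^ n"
      by (intro divide_left_mono power_increasing; simp)+
    moreover have "1 / 2 ^ i0 < (1 :: real) / 2 ^ max m n" and "\<And>q. q \<in> P n \<Longrightarrow> 1 / 2 ^ i0 < \<epsilon> q"
      using i0 by auto
    ultimately show "x - l < 1 / 2 ^ m" "x - l < 1 / 2 ^ n" "\<And>q. q \<in> P n \<Longrightarrow> x - l < \<epsilon> q"
      by fastforce+
    show "l < x"
      using that cyl_Cons_subset[of i s] unfolding l_def cyl_def[of s] by auto
  qed
  have sub: "cyl t \<subseteq> cyl (i # s)"
    unfolding t_def by (rule cyl_append_subset)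
  \<comment> \<open>A shift of a point of \<open>cyl t\<close> comes from a suffix of
    \<open>s\<close>, from the letter \<open>i\<close>, or from a word longer than \<open>t\<close>;
    the padding contributes none.\<close>
  have shape: "g \<in> H \<or> g \<in> h ` P n \<or> g < 1 / 2 ^ m" if "x \<in> cyl t" "x \<in> cyl u" "g \<in> shifts u" for x u g
  proof (cases "length u \<le> length t")
    case False
    then have "m < length u"
      unfolding t_def by simp
    then show ?thesis
      using shifts_less that(3) by blast
  next
    case True
    define j where "j = length t - length u"
    have u: "u = drop j t"
      using cyl_eq_drop[OF that(1,2) True] unfolding j_def .
    consider "j < m" | "j = m" | j' where "j = Suc (m + j')"
      by (metis add_Suc_right less_imp_Suc_add linorder_neqE_nat)
    then show ?thesis
    proof cases
      case 1
      then have "drop j t = z # replicate (m - j - 1) z @ i # s"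
        unfolding t_def by (simp add: Cons_replicate_eq Suc_diff_Suc flip: replicate_Suc append_Cons)
      then show ?thesis
        using that(3) u z by simp
    next
      case 2
      then have "u = i # s"
        unfolding u t_def by simp
      then show ?thesis
        using that(3) i(2) by simp
    next
      case 3
      then have "u = drop j' s"
        unfolding u t_def by simp
      then show ?thesis
        using that(3) unfolding H_def by (cases "j' \<le> length s") auto
    qed
  qed
  have "tuned P \<delta> k x" if x: "x \<in> cyl t" for x
    unfolding tuned_def
  proof (rule exI[of _ n], intro conjI ballI impI)
    show "k \<le> n"
      unfolding n_def by simp
    fix q assume q: "q \<in> P n" "x < q \<and> q < x + 1 / 2 ^ n"
    have xs: "x \<in> cyl (i # s)"
      using x sub by blast
    note nr = near[OF xs]
    have e0: "(1 :: real) / 2 ^ m > 0"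
      by simp
    have ql: "q - l > 3 * (1 / 2 ^ m)"
      using mH[of 0 q] q nr(1) unfolding H_def by auto
    show "\<exists>m\<ge>k. fib x \<inter> {q - 1 / 2 ^ m..q} = {} \<and> fib x \<inter> {q <..< q + \<delta> q m} \<noteq> {}"
    proof (intro exI[of _ m] conjI)
      show "k \<le> m"
        using mk by simp
      have False if y: "y \<in> fib x" "q - 1 / 2 ^ m \<le> y" "y \<le> q" for y
      proof (cases "y = x")
        case True
        then show False
          using y(2) ql nr(2) e0 by linarith
      next
        case False
        then obtain g u where g: "y = x + g" "x \<in> cyl u" "g \<in> shifts u"
          using y(1) unfolding fib_def by blast
        consider "g \<in> H" | q' where "q' \<in> P n" "g = h q'" | "g < 1 / 2 ^ m"
          using shape[OF x g(2,3)] by blast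
        then show False
        proof cases
          case 1
          then show False
            using mH[OF 1 q(1)] y(2,3) g(1) nr(1,2) e0 by linarith
        next
          case 2
          then show False
            using mP[OF 2(1) q(1)] y(2,3) g(1) nr(1,2) h(2,3)[of q'] \<epsilon>(3)[of q']
            by linarith
        next
          case 3
          then show False
            using y(2) g(1) ql nr(2) e0 by linarith
        qed
      qed
      then show "fib x \<inter> {q - 1 / 2 ^ m..q} = {}"
        by auto
      have "1 / 2 ^ j \<le> (1/4) * (1 / 2 ^ length s :: real)" if "length s + 2 \<le> j" for j
      proof -
        have "1 / 2 ^ j \<le> 1 / (2 :: real) ^ (length s + 2)"
          using that by (intro divide_left_mono power_increasing) auto
        then show ?thesis
          by (simp add: power_add)
      qed
      from this[of n] this[of m] have e:
        "1 / 2 ^ n \<le> (1/4) * (1 / 2 ^ length s :: real)" "1 / 2 ^ m \<le> (1/4) * (1 / 2 ^ length s :: real)"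
        using m(1) by (simp_all add: n_def)
      have "h q < 1 / 2 ^ length s"
        using h(3)[of q] q(2) nr(1,3) \<epsilon>(3)[of q] \<epsilon>(1)[of q] e by linarith
      moreover have "h q > 0"
        using h(2)[of q] q(2) nr(1) by linarith
      ultimately have "h q \<in> shifts (i # s)"
        using i(2) q(1) by simp
      then have "x + h q \<in> fib x"
        unfolding fib_def using xs by blast
      moreover have "q < x + h q" "x + h q < q + \<delta> q m"
        using h(2,3)[of q] nr(1) nr(4)[OF q(1)] \<epsilon>(2)[of q] by linarith+
      ultimately show "fib x \<inter> {q <..< q + \<delta> q m} \<noteq> {}"
        by auto
    qed
  qed
  moreover have "cyl t \<subseteq> cyl s"
    using sub cyl_Cons_subset by blast
  ultimately show ?thesis
    by blast
qed

text \<open>Every nonempty open subset of the unit interval contains some \<open>cyl s\<close> and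
  hence some \<open>cyl t\<close> consisting of tuned points. So for each of the countably many
  \<open>k\<close> the exceptional points form a nowhere dense set.\<close>

lemma meager_not_tuned:
  assumes "\<And>n. finite (P n)" "\<And>q m. \<delta> q m > 0"
  shows "meager {x \<in> {0<..<1}. \<exists>k. \<not> tuned P \<delta> k x}"
proof -
  have "nowhere_dense {x \<in> {0<..<1}. \<not> tuned P \<delta> k x}" (is "nowhere_dense ?B") for k
    unfolding nowhere_dense_def
  proof (rule ccontr)
    let ?J = "interior (closure ?B)"
    assume "?J \<noteq> {}"
    then have "?J \<inter> ?B \<noteq> {}"
      using open_Int_closure_eq_empty[of ?J ?B] interior_subset[of "closure ?B"] by blast
    then have "?J \<inter> {0<..<1} \<noteq> {}" "open (?J \<inter> {0<..<1})" "?J \<inter> {0<..<1} \<subseteq> {0<..<1}"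
      by auto
    then obtain s where "cyl s \<subseteq> ?J"
      using ex_cyl_subset[of "?J \<inter> {0<..<1}"] by force
    moreover obtain t where t: "cyl t \<subseteq> cyl s" "\<And>x. x \<in> cyl t \<Longrightarrow> tuned P \<delta> k x"
      using ex_cyl_tuned[of P \<delta> s k, OF assms] by blast
    ultimately have "cyl t \<subseteq> closure ?B"
      using interior_subset by blast
    then have "cyl t \<inter> ?B \<noteq> {}"
      using open_Int_closure_eq_empty[OF open_cyl[of t], of ?B] cyl_nonempty[of t] by blast
    then show False
      using t(2) by blast
  qed
  then have "meager (\<Union>k. {x \<in> {0<..<1}. \<not> tuned P \<delta> k x})"
    by (intro meager_UN nowhere_dense_imp_meager) auto
  moreover have "(\<Union>k. {x \<in> {0<..<1}. \<not> tuned P \<delta> k x}) = {x \<in> {0<..<1}. \<exists>k. \<not> tuned P \<delta> k x}"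
    by auto
  ultimately show ?thesis
    by simp
qed

subsection \<open>The space\<close>

text \<open>
  The point \<open>(y, x)\<close> is encoded by the function \<open>u\<close> with \<open>u 0 = y\<close> that is the indicator
  of \<open>{x}\<close> outside \<open>0\<close>; for \<open>(y, \<infinity>)\<close> it vanishes outside \<open>0\<close>.
\<close>
definition fibspace :: "real set \<Rightarrow> (real \<Rightarrow> real) set" where
  "fibspace L = {u. u 0 \<in> {0..2} \<and> (\<forall>t. t \<noteq> 0 \<longrightarrow> u t \<in> {0,1}) \<and> (\<forall>t. t \<noteq> 0 \<and> t \<notin> L \<longrightarrow> u t = 0) \<and>
     (\<forall>s t. s \<noteq> t \<and> s \<noteq> 0 \<and> t \<noteq> 0 \<longrightarrow> u s = 0 \<or> u t = 0) \<and> (\<forall>x\<in>L. u x = 0 \<or> u 0 \<in> fib x)}"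

definition base_pt :: "real \<Rightarrow> real \<Rightarrow> real" where
  "base_pt y = (\<lambda>t. 0)(0 := y)"

definition fib_pt :: "real \<Rightarrow> real \<Rightarrow> real \<Rightarrow> real" where
  "fib_pt x y = (\<lambda>t. 0)(0 := y, x := 1)"

lemma base_pt_simps [simp]: "base_pt y 0 = y" "t \<noteq> 0 \<Longrightarrow> base_pt y t = 0"
  by (auto simp: base_pt_def)

lemma fib_pt_simps [simp]: "x \<noteq> 0 \<Longrightarrow> fib_pt x y 0 = y" "fib_pt x y x = 1"
    "t \<noteq> 0 \<Longrightarrow> t \<noteq> x \<Longrightarrow> fib_pt x y t = 0"
  by (auto simp: fib_pt_def)

lemma fib_subset: "0 < x \<Longrightarrow> x < 1 \<Longrightarrow> fib x \<subseteq> {0..2}"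
  using fib_ge fib_less by fastforce

text \<open>Each defining condition restricts one or two coordinates to a closed set, the last one
  because the sets \<open>fib x\<close> are closed. So the space is closed in a compact
  cube.\<close>

lemma compact_fibspace: "compact (fibspace L)"
proof -
  have ev: "continuous_on UNIV (\<lambda>u. u i)" for i :: real
    by (rule continuous_on_product_coordinates)
  have cl: "closed {u :: real \<Rightarrow> real. u i \<in> C}" if "closed C" for i C
    using closed_vimage[OF that ev[of i]]
    by (simp add: vimage_def)
  have cl0: "closed {u :: real \<Rightarrow> real. u i = 0}" for i
    using cl[of "{0}" i] by simp
  have "fibspace L = {u. u 0 \<in> {0..2}} \<inter> (\<Inter>t\<in>-{0}. {u. u t \<in> {0,1}}) \<inter> (\<Inter>t\<in>-insert 0 L. {u. u t = 0}) \<inter>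
     (\<Inter>(s,t)\<in>{(s,t). s \<noteq> t \<and> s \<noteq> 0 \<and> t \<noteq> 0}. {u. u s = 0} \<union> {u. u t = 0}) \<inter>
     (\<Inter>x\<in>L. {u. u x = 0} \<union> {u. u 0 \<in> fib x})"
    unfolding fibspace_def by auto
  also have "closed \<dots>"
    by (intro closed_Int closed_INT ballI closed_Un cl cl0 closed_fib)
       (auto intro!: closed_Un cl0)
  finally have "closed (fibspace L)" .
  moreover have "compact (PiE UNIV (\<lambda>_ :: real. {0..2 :: real}))"
    using compactin_PiE[of "\<lambda>_. euclideanreal" UNIV "\<lambda>_. {0..2}"]
    by (simp add: euclidean_product_topology)
  moreover have "fibspace L \<subseteq> PiE UNIV (\<lambda>_ :: real. {0..2 :: real})"
  proof
    fix u assume "u \<in> fibspace L"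
    then have "u t \<in> {0..2}" for t
      unfolding fibspace_def by (cases "t = 0") force+
    then show "u \<in> PiE UNIV (\<lambda>_ :: real. {0..2 :: real})"
      by auto
  qed
  ultimately show ?thesis
    by (metis closed_Int_compact inf.absorb1)
qed

text \<open>Keeping \<open>L\<close> in the open unit interval frees the index \<open>0\<close> for
  the first coordinate and keeps every \<open>fib x\<close> inside \<open>{0..2}\<close>.\<close>

locale fibred =
  fixes L :: "real set"
  assumes L_unit: "L \<subseteq> {0<..<1}"
begin

lemma L_nonzero: "x \<in> L \<Longrightarrow> x \<noteq> 0"
  using L_unit by auto

lemma base_pt_in_fibspace: "y \<in> {0..2} \<Longrightarrow> base_pt y \<in> fibspace L"
  using L_nonzero by (auto simp: fibspace_def)

lemma fib_pt_in_fibspace: "x \<in> L \<Longrightarrow> y \<in> fib x \<Longrightarrow> fib_pt x y \<in> fibspace L"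
proof -
  assume xy: "x \<in> L" "y \<in> fib x"
  then have "0 < x" "x < 1"
    using L_unit by auto
  then have "y \<in> {0..2}"
    using fib_subset[of x] xy(2) by blast
  then show ?thesis
    using xy L_nonzero by (auto simp: fibspace_def fib_pt_def)
qed

lemma fibspace_fib: "u \<in> fibspace L \<Longrightarrow> x \<in> L \<Longrightarrow> u x \<noteq> 0 \<Longrightarrow> u 0 \<in> fib x"
  by (auto simp: fibspace_def)

lemma fibspace_val: "u \<in> fibspace L \<Longrightarrow> x \<in> L \<Longrightarrow> u x = 0 \<or> u x = 1"
  using L_nonzero by (auto simp: fibspace_def)

lemma fibspace_unique: "u \<in> fibspace L \<Longrightarrow> x \<in> L \<Longrightarrow> y \<in> L \<Longrightarrow> u x \<noteq> 0 \<Longrightarrow> u y \<noteq> 0 \<Longrightarrow> x = y"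
  using L_nonzero unfolding fibspace_def by blast

lemma fibspace_0: "u \<in> fibspace L \<Longrightarrow> u 0 \<in> {0..2}"
  by (simp add: fibspace_def)

lemma fibspace_outside: "u \<in> fibspace L \<Longrightarrow> t \<noteq> 0 \<Longrightarrow> t \<notin> L \<Longrightarrow> u t = 0"
  by (simp add: fibspace_def)

lemma fibspace_ext: "u \<in> fibspace L \<Longrightarrow> v \<in> fibspace L \<Longrightarrow> u 0 = v 0 \<Longrightarrow> (\<And>x. x \<in> L \<Longrightarrow> u x = v x) \<Longrightarrow> u = v"
  by (rule ext) (metis fibspace_outside)

lemma fibspace_fib_pt:
  assumes "u \<in> fibspace L" "x \<in> L" "u x \<noteq> 0"
  shows "u = fib_pt x (u 0)"
proof (rule fibspace_ext[OF assms(1)])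
  show "fib_pt x (u 0) \<in> fibspace L"
    using fib_pt_in_fibspace fibspace_fib assms by blast
  show "u t = fib_pt x (u 0) t" if "t \<in> L" for t
    using that assms fibspace_unique[OF assms(1,2) that] fibspace_val[OF assms(1,2)] L_nonzero[OF that]
    by (cases "t = x") auto
qed (use L_nonzero assms in auto)

lemma fibspace_base_pt:
  assumes "u \<in> fibspace L" "\<And>x. x \<in> L \<Longrightarrow> u x = 0"
  shows "u = base_pt (u 0)"
  by (rule fibspace_ext[OF assms(1)]) (use assms fibspace_0 base_pt_in_fibspace L_nonzero in auto)

lemma fibspace_cases:
  assumes "u \<in> fibspace L"
  obtains (base) y where "y \<in> {0..2}" "u = base_pt y"
  | (fib) x y where "x \<in> L" "y \<in> fib x" "u = fib_pt x y"
  using assms fibspace_base_pt fibspace_fib_pt fibspace_0 fibspace_fib by metis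

section \<open>Basic open and closed sets of the space\<close>

lemma openin_fibspace_0: "open G \<Longrightarrow> openin (top_of_set (fibspace L)) {v \<in> fibspace L. v 0 \<in> G}"
  by (rule continuous_openin_preimage_gen[of "fibspace L" "\<lambda>v. v 0" G, unfolded vimage_def Int_def, simplified])
     (auto intro: continuous_on_subset[OF continuous_on_product_coordinates])

lemma closedin_fibspace_0: "closed C \<Longrightarrow> closedin (top_of_set (fibspace L)) {v \<in> fibspace L. v 0 \<in> C}"
  by (rule continuous_closedin_preimage[of "fibspace L" "\<lambda>v. v 0" C, unfolded vimage_def Int_def, simplified])
     (auto intro: continuous_on_subset[OF continuous_on_product_coordinates])

text \<open>Coordinates in \<open>L\<close> only take the values \<open>0\<close> and
  \<open>1\<close>, which balls of radius \<open>1/2\<close> separate.\<close>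

lemma openin_fibspace_coord: "x \<in> L \<Longrightarrow> openin (top_of_set (fibspace L)) {v \<in> fibspace L. v x = c}"
proof -
  assume x: "x \<in> L"
  have op: "openin (top_of_set (fibspace L)) (fibspace L \<inter> (\<lambda>v. v x) -` ball c (1/2))" if "c = 0 \<or> c = 1" for c :: real
    by (rule continuous_openin_preimage_gen)
       (auto intro: continuous_on_subset[OF continuous_on_product_coordinates])
  have eq: "fibspace L \<inter> (\<lambda>v. v x) -` ball c (1/2) = {v \<in> fibspace L. v x = c}" if "c = 0 \<or> c = 1" for c :: real
  proof -
    have "v x \<in> ball c (1/2) \<longleftrightarrow> v x = c" if "v \<in> fibspace L" for v
      using fibspace_val[OF that x] \<open>c = 0 \<or> c = 1\<close> by (elim disjE) (simp_all add: dist_real_def)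
    then show ?thesis
      by blast
  qed
  show ?thesis
  proof (cases "c = 0 \<or> c = 1")
    case True
    then show ?thesis
      using op eq by simp
  next
    case False
    then have "{v \<in> fibspace L. v x = c} = {}"
      using fibspace_val[OF _ x] by auto
    then show ?thesis
      by (simp only: openin_empty)
  qed
qed

lemma openin_fibspace_coords: "finite W \<Longrightarrow> W \<subseteq> L \<Longrightarrow> openin (top_of_set (fibspace L)) {v \<in> fibspace L. \<forall>x\<in>W. v x = c x}"
proof (induction W rule: finite_induct)
  case (insert x W)
  then have "openin (top_of_set (fibspace L)) ({v \<in> fibspace L. v x = c x} \<inter> {v \<in> fibspace L. \<forall>x\<in>W. v x = c x})"
    by (intro openin_Int openin_fibspace_coord) auto
  moreover have "{v \<in> fibspace L. v x = c x} \<inter> {v \<in> fibspace L. \<forall>x\<in>W. v x = c x} = {v \<in> fibspace L. \<forall>x\<in>insert x W. v x = c x}"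
    by auto
  ultimately show ?case
    by simp
qed (simp add: openin_subtopology_refl)

lemma openin_fibspace_box:
  assumes "finite W" "W \<subseteq> L" "open G"
  shows "openin (top_of_set (fibspace L)) {v \<in> fibspace L. v 0 \<in> G \<and> (\<forall>x\<in>W. v x = c x)}"
proof -
  have "openin (top_of_set (fibspace L)) ({v \<in> fibspace L. v 0 \<in> G} \<inter> {v \<in> fibspace L. \<forall>x\<in>W. v x = c x})"
    using assms by (intro openin_Int openin_fibspace_0 openin_fibspace_coords)
  moreover have "{v \<in> fibspace L. v 0 \<in> G} \<inter> {v \<in> fibspace L. \<forall>x\<in>W. v x = c x} = {v \<in> fibspace L. v 0 \<in> G \<and> (\<forall>x\<in>W. v x = c x)}"
    by auto
  ultimately show ?thesis
    by simp
qed

text \<open>A basic open set of the product restricts finitely many coordinates, and outside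
  \<open>insert 0 L\<close> all points agree, being \<open>0\<close> there.\<close>

lemma fibspace_nhd:
  assumes "openin (top_of_set (fibspace L)) U" "u \<in> U"
  shows "\<exists>e>0. \<exists>W. finite W \<and> W \<subseteq> L \<and>
    (\<forall>v\<in>fibspace L. \<bar>v 0 - u 0\<bar> < e \<longrightarrow> (\<forall>x\<in>W. v x = u x) \<longrightarrow> v \<in> U)"
proof -
  obtain T where T: "open T" "U = fibspace L \<inter> T"
    using assms(1) by (auto simp: openin_open)
  then have "u \<in> fibspace L" "u \<in> T"
    using assms(2) by auto
  have open_T: "openin (product_topology (\<lambda>_. euclidean) UNIV) T"
    using T(1) by (simp add: euclidean_product_topology)
  define P where "P X \<longleftrightarrow> u \<in> PiE UNIV X \<and> (\<forall>i. open (X i)) \<and> finite {i. X i \<noteq> UNIV} \<and> PiE UNIV X \<subseteq> T"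
    for X :: "real \<Rightarrow> real set"
  have "\<exists>X. P X"
    using product_topology_open_contains_basis[OF open_T \<open>u \<in> T\<close>] unfolding P_def by simp
  then obtain X where "P X"
    by blast
  then have X: "u \<in> PiE UNIV X" "\<forall>i. open (X i)" "finite {i. X i \<noteq> UNIV}" "PiE UNIV X \<subseteq> T"
    unfolding P_def by simp_all
  have uX: "u i \<in> X i" for i
    by (rule PiE_mem[OF X(1) UNIV_I])
  then have "\<exists>e>0. ball (u 0) e \<subseteq> X 0"
    using X(2) open_contains_ball[of "X 0"] uX[of 0] by simp
  then obtain e where e: "e > 0" "ball (u 0) e \<subseteq> X 0"
    by blast
  show ?thesis
  proof (rule exI[of _ e], rule conjI[OF e(1)], rule exI[of _ "{i. X i \<noteq> UNIV} \<inter> L"], intro conjI ballI impI)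
    show "finite ({i. X i \<noteq> UNIV} \<inter> L)" "{i. X i \<noteq> UNIV} \<inter> L \<subseteq> L"
      using e X(3) by auto
    fix v assume v: "v \<in> fibspace L" "\<bar>v 0 - u 0\<bar> < e" "\<forall>x\<in>{i. X i \<noteq> UNIV} \<inter> L. v x = u x"
    have "v i \<in> X i" for i
    proof -
      consider "i = 0" | "i \<noteq> 0" "i \<notin> L" | "i \<in> L" "X i = UNIV" | "i \<in> L" "X i \<noteq> UNIV"
        by blast
      then show ?thesis
      proof cases
        case 1
        then show ?thesis
          using v(2) e(2) by (auto simp: dist_real_def)
      next
        case 2
        then have "v i = u i"
          using fibspace_outside v(1) \<open>u \<in> fibspace L\<close> by metis
        then show ?thesis
          using uX[of i] by simp
      next
        case 4
        then have "v i = u i"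
          using v(3) by blast
        then show ?thesis
          using uX[of i] by simp
      qed simp
    qed
    then show "v \<in> U"
      using X(4) T(2) v(1) by blast
  qed
qed

text \<open>All shifts are rational, so such an \<open>x\<close> differs from \<open>y\<close> by a
  rational.\<close>

lemma countable_fibres: "countable {x \<in> L. y \<in> fib x}"
proof (rule countable_subset)
  show "{x \<in> L. y \<in> fib x} \<subseteq> (\<lambda>r. y - r) ` \<rat>"
  proof
    fix x assume "x \<in> {x \<in> L. y \<in> fib x}"
    then have "y - x \<in> \<rat>"
      using fib_Rats by blast
    then show "x \<in> (\<lambda>r. y - r) ` \<rat>"
      by (intro image_eqI[of _ _ "y - x"]) auto
  qed
qed (simp add: countable_rat)

text \<open>Only the countably many coordinates in \<open>Z\<close> have to be prescribed: for any
  other \<open>x\<close> in \<open>L\<close> the closed set \<open>fib x\<close> misses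
  \<open>u 0\<close>, so coordinate \<open>x\<close> vanishes at all points whose first coordinate
  is close to \<open>u 0\<close>.\<close>

lemma first_countable_fibspace: "first_countable (top_of_set (fibspace L))"
  unfolding first_countable_def
proof
  fix u assume "u \<in> topspace (top_of_set (fibspace L))"
  then have u: "u \<in> fibspace L"
    by simp
  define Z where "Z = {x \<in> L. u 0 \<in> fib x}"
  define N where "N = (\<lambda>(k, W). {v \<in> fibspace L. v 0 \<in> ball (u 0) (1 / real (Suc k)) \<and> (\<forall>x\<in>W. v x = u x)})"
  let ?\<B> = "N ` (UNIV \<times> {W. finite W \<and> W \<subseteq> Z})"
  show "\<exists>\<B>. countable \<B> \<and> (\<forall>V\<in>\<B>. openin (top_of_set (fibspace L)) V) \<and>
      (\<forall>U. openin (top_of_set (fibspace L)) U \<and> u \<in> U \<longrightarrow> (\<exists>V\<in>\<B>. u \<in> V \<and> V \<subseteq> U))"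
  proof (intro exI[of _ ?\<B>] conjI ballI allI impI)
    show "countable ?\<B>"
      using countable_fibres unfolding Z_def
      by (intro countable_image countable_SIGMA countable_Collect_finite_subset) auto
    fix V assume "V \<in> ?\<B>"
    then obtain k W where W: "finite W" "W \<subseteq> Z" "V = N (k, W)"
      by auto
    then have "W \<subseteq> L"
      unfolding Z_def by auto
    then show "openin (top_of_set (fibspace L)) V"
      unfolding W(3) N_def using openin_fibspace_box[of W "ball (u 0) (1 / real (Suc k))" u] W(1) by simp
  next
    fix U assume U: "openin (top_of_set (fibspace L)) U \<and> u \<in> U"
    then obtain e W where e: "e > 0" "finite W" "W \<subseteq> L" and
      W: "\<forall>v\<in>fibspace L. \<bar>v 0 - u 0\<bar> < e \<longrightarrow> (\<forall>x\<in>W. v x = u x) \<longrightarrow> v \<in> U"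
      using fibspace_nhd[of U u] by auto
    have op: "open (- (\<Union>x\<in>W - Z. fib x))"
      using e(2) by (intro open_Compl closed_UN) (auto simp: closed_fib)
    have mem: "u 0 \<in> - (\<Union>x\<in>W - Z. fib x)"
      using e(3) unfolding Z_def by auto
    obtain d where d: "d > 0" "ball (u 0) d \<subseteq> - (\<Union>x\<in>W - Z. fib x)"
      using iffD1[OF open_contains_ball_eq[OF op] mem] by (elim exE conjE)
    obtain k where k: "1 / real (Suc k) < min d e"
      using reals_Archimedean[of "min d e"] d(1) e(1) unfolding inverse_eq_divide by auto
    have "N (k, W \<inter> Z) \<subseteq> U"
    proof
      fix v assume "v \<in> N (k, W \<inter> Z)"
      then have v: "v \<in> fibspace L" "dist (u 0) (v 0) < 1 / real (Suc k)" "\<And>x. x \<in> W \<inter> Z \<Longrightarrow> v x = u x"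
        unfolding N_def by auto
      show "v \<in> U"
      proof (rule W[rule_format, OF v(1)])
        show "\<bar>v 0 - u 0\<bar> < e"
          using v(2) k unfolding dist_real_def by linarith
        fix x assume x: "x \<in> W"
        show "v x = u x"
        proof (cases "x \<in> Z")
          case False
          have "v 0 \<in> ball (u 0) d"
            using v(2) k unfolding mem_ball by linarith
          then have "v 0 \<notin> fib x"
            using d(2) x False by blast
          then have "v x = 0"
            using fibspace_fib[OF v(1)] x e(3) by blast
          moreover have "u x = 0"
            using fibspace_fib[OF u] x e(3) False unfolding Z_def by blast
          ultimately show ?thesis
            by simp
        qed (use v(3) x in blast)
      qed
    qed
    moreover have "u \<in> N (k, W \<inter> Z)"
      using u unfolding N_def by auto
    ultimately show "\<exists>V\<in>?\<B>. u \<in> V \<and> V \<subseteq> U"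
      using e(2) by blast
  qed
qed

text \<open>The identity is the embedding. The points are functions on the real line that vanish
  outside at most two places, hence pointwise limits of combinations of two tent functions.\<close>

lemma Rosenthal_compact_fibspace: "Rosenthal_compact (top_of_set (fibspace L))"
  unfolding Rosenthal_compact_def
proof (intro conjI exI)
  show "compact_space (top_of_set (fibspace L))"
    by (simp add: compact_space_subtopology compact_fibspace)
  show "Polish_space euclideanreal"
  proof -
    have "closure \<rat> = (UNIV :: real set)"
      by (rule Rats_closure_real)
    then show ?thesis
      unfolding Polish_space_def separable_space_def
      using countable_rat by (auto simp: completely_metrizable_space_euclidean)
  qed
  have "fibspace L \<subseteq> Baire_one euclideanreal"
  proof
    fix u assume u: "u \<in> fibspace L"
    define tent where "tent a n t = max 0 (1 - real n * \<bar>t - a\<bar>)" for a t :: real and n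
    have lim: "(\<lambda>n. tent a n t) \<longlonglongrightarrow> (if t = a then 1 else 0)" for a t
    proof (cases "t = a")
      case False
      then have "eventually (\<lambda>n. 1 / \<bar>t - a\<bar> < real n) sequentially"
        using filterlim_real_sequentially unfolding filterlim_at_top_dense by blast
      then have "eventually (\<lambda>n. tent a n t = 0) sequentially"
        by eventually_elim (use False in \<open>simp add: tent_def field_simps\<close>)
      then show ?thesis
        using False by (simp add: tendsto_eventually)
    qed (simp add: tent_def)
    have cont: "continuous_on UNIV (tent a n)" for a n
      unfolding tent_def by (intro continuous_intros)
    have "\<exists>a y b. u = (\<lambda>t. y * (if t = 0 then 1 else 0) + b * (if t = a then 1 else 0))"
      using u
    proof (cases rule: fibspace_cases)
      case (base y)
      then show ?thesis
        by (intro exI[of _ 0] exI[of _ y] exI[of _ 0]) (auto simp: base_pt_def)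
    next
      case (fib x y)
      then show ?thesis
        using L_nonzero by (intro exI[of _ x] exI[of _ y] exI[of _ 1]) (auto simp: fib_pt_def)
    qed
    then obtain a y b where eq: "u = (\<lambda>t. y * (if t = 0 then 1 else 0) + b * (if t = a then 1 else 0))"
      by blast
    show "u \<in> Baire_one euclideanreal"
      unfolding Baire_one_def
    proof (intro CollectI conjI exI[of _ "\<lambda>n t. y * tent 0 n t + b * tent a n t"] allI ballI)
      show "continuous_map euclideanreal euclideanreal (\<lambda>t. y * tent 0 n t + b * tent a n t)" for n
      proof -
        have "continuous_on UNIV (\<lambda>t. y * tent 0 n t + b * tent a n t)"
          by (intro continuous_on_add continuous_on_mult continuous_on_const cont)
        then show ?thesis
          by simp
      qed
      show "(\<lambda>n. y * tent 0 n t + b * tent a n t) \<longlonglongrightarrow> u t" for t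
        unfolding eq by (intro tendsto_intros lim)
    qed auto
  qed
  then show "embedding_map (top_of_set (fibspace L)) (Baire_one_topology euclideanreal) id"
    by (simp add: embedding_map_def Baire_one_topology_def euclidean_product_topology
        subtopology_subtopology inf.absorb2)
qed

end

section \<open>Finite subsets and the weight of the space\<close>

lemma card_Fpow_ordLeq:
  assumes "|A| \<le>o r" "Card_order r" "infinite (Field r)"
  shows "|{W. finite W \<and> W \<subseteq> A}| \<le>o r"
proof -
  let ?P = "\<lambda>n. {W. finite W \<and> W \<subseteq> A \<and> card W = n}"
  have nat: "natLeq \<le>o r"
    using infinite_iff_natLeq_ordLeq assms(2,3) card_of_Field_ordIso ordLeq_ordIso_trans by blast
  have "|?P n| \<le>o r" for n
  proof (induction n)
    case 0
    have "?P 0 \<subseteq> {{}}"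
      by auto
    then have "finite (?P 0)"
      using finite_subset by blast
    then show ?case
      using countable_iff_ordLeq_natLeq countable_finite ordLeq_transitive nat by blast
  next
    case (Suc n)
    have "?P (Suc n) \<subseteq> (\<lambda>(a, W). insert a W) ` (A \<times> ?P n)"
    proof
      fix W assume W: "W \<in> ?P (Suc n)"
      then obtain a where "a \<in> W"
        by (metis (mono_tags, lifting) card.empty ex_in_conv mem_Collect_eq nat.distinct(1))
      with W show "W \<in> (\<lambda>(a, W). insert a W) ` (A \<times> ?P n)"
        by (intro image_eqI[of _ _ "(a, W - {a})"]) auto
    qed
    then have "|?P (Suc n)| \<le>o |A \<times> ?P n|"
      by (rule ordLeq_transitive[OF card_of_mono1 card_of_image])
    moreover have "|A \<times> ?P n| \<le>o r"
      using assms Suc by (intro card_of_Times_ordLeq_infinite_Field) auto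
    ultimately show ?case
      by (rule ordLeq_transitive)
  qed
  moreover have "|UNIV :: nat set| \<le>o r"
    using nat card_of_nat ordIso_ordLeq_trans by blast
  ultimately have "|\<Union>n. ?P n| \<le>o r"
    using assms by (intro card_of_UNION_ordLeq_infinite_Field) auto
  moreover have "(\<Union>n. ?P n) = {W. finite W \<and> W \<subseteq> A}"
    by auto
  ultimately show ?thesis
    by simp
qed

context fibred
begin

definition slab :: "real \<Rightarrow> real \<Rightarrow> real set \<Rightarrow> real \<Rightarrow> (real \<Rightarrow> real) set" where
  "slab p q W c = {v \<in> fibspace L. v 0 \<in> {p<..<q} \<and> (\<forall>x\<in>W. v x = c)}"

text \<open>At a point over infinity a neighbourhood prescribes zeros at finitely many indices. At a
  point over \<open>x\<close> the single condition that coordinate \<open>x\<close> is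
  \<open>1\<close> already determines all coordinates in \<open>L\<close>.\<close>

lemma base_of_fibspace:
  "base_of (top_of_set (fibspace L))
    ((\<lambda>((p, q), W). slab p q W 0) ` ((\<rat> \<times> \<rat>) \<times> {W. finite W \<and> W \<subseteq> L}) \<union>
     (\<lambda>((p, q), x). slab p q {x} 1) ` ((\<rat> \<times> \<rat>) \<times> L))"
    (is "base_of _ (?A \<union> ?B)")
proof -
  have "openin (top_of_set (fibspace L)) V" if V: "V \<in> ?A \<union> ?B" for V
  proof -
    from V have "\<exists>p q W c. finite W \<and> W \<subseteq> L \<and> V = slab p q W c"
    proof
      assume "V \<in> ?B"
      then obtain p q x where "x \<in> L" "V = slab p q {x} 1"
        by auto
      then show ?thesis
        by (intro exI[of _ p] exI[of _ q] exI[of _ "{x}"] exI[of _ 1]) simp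
    qed auto
    then obtain p q W c where "finite W" "W \<subseteq> L" "V = slab p q W c"
      by auto
    then show "openin (top_of_set (fibspace L)) V"
      unfolding slab_def using openin_fibspace_box[of W "{p<..<q}" "\<lambda>_. c"] by simp
  qed
  then have op: "\<forall>V\<in>?A \<union> ?B. openin (top_of_set (fibspace L)) V"
    by (rule ballI)
  have "\<exists>V\<in>?A \<union> ?B. u \<in> V \<and> V \<subseteq> U" if U: "openin (top_of_set (fibspace L)) U \<and> u \<in> U" for U u
  proof -
    from U have u: "u \<in> fibspace L"
      using openin_imp_subset by blast
    from U obtain e W where e: "e > 0" "finite W" "W \<subseteq> L" and
      W: "\<forall>v\<in>fibspace L. \<bar>v 0 - u 0\<bar> < e \<longrightarrow> (\<forall>x\<in>W. v x = u x) \<longrightarrow> v \<in> U"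
      using fibspace_nhd[of U u] by auto
    obtain p where p: "p \<in> \<rat>" "u 0 - e < p" "p < u 0"
      using Rats_dense_in_real[of "u 0 - e" "u 0"] e(1) by auto
    obtain q where q: "q \<in> \<rat>" "u 0 < q" "q < u 0 + e"
      using Rats_dense_in_real[of "u 0" "u 0 + e"] e(1) by auto
    show ?thesis
    proof (cases "\<exists>x\<in>L. u x \<noteq> 0")
      case True
      then obtain x where x: "x \<in> L" "u x \<noteq> 0"
        by blast
      then have ux: "u x = 1"
        using fibspace_val u by blast
      have "v \<in> U" if "v \<in> slab p q {x} 1" for v
      proof (rule W[rule_format])
        show "v \<in> fibspace L" "\<bar>v 0 - u 0\<bar> < e"
          using that p q unfolding slab_def by auto
        have "v x = 1"
          using that unfolding slab_def by simp
        then show "v y = u y" if "y \<in> W" for y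
          using fibspace_unique[OF \<open>v \<in> fibspace L\<close> x(1), of y] fibspace_unique[OF u x(1), of y] ux subsetD[OF e(3) that]
          by (metis zero_neq_one)
      qed
      then have "slab p q {x} 1 \<subseteq> U"
        by blast
      moreover have "u \<in> slab p q {x} 1"
        using u p q ux unfolding slab_def by simp
      ultimately show ?thesis
        using p(1) q(1) x(1) by (intro bexI[of _ "slab p q {x} 1"] UnI2 image_eqI[of _ _ "((p, q), x)"]) auto
    next
      case False
      have "slab p q W 0 \<subseteq> U"
        using W False e(3) p q unfolding slab_def by force
      moreover have "u \<in> slab p q W 0"
        using u p q False e(3) unfolding slab_def by auto
      ultimately show ?thesis
        using p(1) q(1) e(2,3) by (intro bexI[of _ "slab p q W 0"] UnI1 image_eqI[of _ _ "((p, q), W)"]) auto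
    qed
  qed
  with op show ?thesis
    unfolding base_of_def by (intro conjI allI impI)
qed

text \<open>The explicit base has at most \<open>omega1\<close> members. Conversely, any base has
  for each \<open>x\<close> in \<open>L\<close> a nonempty member inside the fibre over
  \<open>x\<close>, and distinct fibres are disjoint.\<close>

lemma weight_fibspace:
  assumes "uncountable L" "|L| \<le>o omega1"
  shows "weight_eq (top_of_set (fibspace L)) omega1"
proof -
  have unc: "uncountable \<B>" if \<B>: "base_of (top_of_set (fibspace L)) \<B>" for \<B>
  proof
    assume "countable \<B>"
    define T where "T x = {v \<in> fibspace L. v x = 1}" for x
    have T: "openin (top_of_set (fibspace L)) (T x)" "fib_pt x x \<in> T x" if "x \<in> L" for x
      using openin_fibspace_coord[OF that, of 1] fib_pt_in_fibspace[OF that fib_self] by (auto simp: T_def)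
    have "\<exists>V\<in>\<B>. fib_pt x x \<in> V \<and> V \<subseteq> T x" if "x \<in> L" for x
      using \<B> T[OF that] unfolding base_of_def by blast
    then obtain V where V: "\<And>x. x \<in> L \<Longrightarrow> V x \<in> \<B> \<and> fib_pt x x \<in> V x \<and> V x \<subseteq> T x"
      by metis
    have "inj_on V L"
    proof (rule inj_onI)
      fix x y assume xy: "x \<in> L" "y \<in> L" "V x = V y"
      then have "fib_pt x x \<in> T y"
        using V by blast
      then have "fib_pt x x y = 1"
        unfolding T_def by simp
      then show "x = y"
        using L_nonzero[OF xy(2)] by (metis fib_pt_simps(3) zero_neq_one)
    qed
    moreover have "V ` L \<subseteq> \<B>"
      using V by blast
    ultimately show False
      using countable_image_inj_on[OF countable_subset[OF _ \<open>countable \<B>\<close>]] assms(1) by blast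
  qed
  obtain \<B> where \<B>: "base_of (top_of_set (fibspace L)) \<B>" "|\<B>| \<le>o omega1"
  proof (rule that[OF base_of_fibspace])
    have R: "|\<rat> \<times> \<rat> :: (real \<times> real) set| \<le>o omega1"
      using countable_iff_ordLess_omega1[of "\<rat> \<times> \<rat> :: (real \<times> real) set"] ordLess_imp_ordLeq
      by (auto simp: countable_rat)
    note T = card_of_Times_ordLeq_infinite_Field[OF infinite_Field_omega1 R _ Card_order_omega1]
    note I = ordLeq_transitive[OF card_of_image T]
    show "|(\<lambda>((p, q), W). slab p q W 0) ` ((\<rat> \<times> \<rat>) \<times> {W. finite W \<and> W \<subseteq> L}) \<union>
     (\<lambda>((p, q), x). slab p q {x} 1) ` ((\<rat> \<times> \<rat>) \<times> L)| \<le>o omega1"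
      by (intro card_of_Un_ordLeq_infinite_Field I card_Fpow_ordLeq assms(2) infinite_Field_omega1 Card_order_omega1)
  qed
  then have "|\<B>| =o omega1"
    using unc uncountable_iff_omega1_ordLeq ordIso_iff_ordLeq by blast
  then show ?thesis
    unfolding weight_eq_def least_cardinality_def
    using \<B>(1) unc uncountable_iff_omega1_ordLeq by blast
qed

end

subsection \<open>Hereditary paracompactness\<close>

text \<open>An open subset of the frontier misses \<open>G\<close> but lies in its closure, so it is
  empty.\<close>

lemma nowhere_dense_frontier:
  assumes "open (G :: real set)"
  shows "nowhere_dense (frontier G)"
proof -
  let ?J = "interior (frontier G)"
  have "?J \<subseteq> frontier G"
    by (rule interior_subset)
  then have "?J \<inter> G = {}" "?J \<subseteq> closure G"
    using assms by (auto simp: frontier_def interior_open)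
  then have "?J = {}"
    using open_Int_closure_eq_empty[of ?J G] by auto
  then show ?thesis
    by (simp add: nowhere_dense_def closure_closed)
qed

text \<open>To the right of the midpoint between \<open>x\<close> and \<open>y\<close> there are
  only finitely many points of \<open>fib x\<close>.\<close>

lemma fib_isolated:
  assumes "y \<in> fib x" "y \<noteq> x"
  shows "\<exists>e>0. \<forall>t\<in>fib x. \<bar>t - y\<bar> < e \<longrightarrow> t = y"
proof -
  have "x < y"
    using fib_ge[OF assms(1)] assms(2) by simp
  then have pos: "(y - x) / 2 > 0"
    by simp
  let ?A = "fib x \<inter> {x + (y - x) / 2..} - {y}"
  have "finite ?A"
    using finite_fib_ge[OF pos, of x] by simp
  then have op: "open (- ?A)"
    by (intro open_Compl finite_imp_closed)
  have "y \<in> - ?A"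
    by simp
  then obtain e where e: "e > 0" "ball y e \<subseteq> - ?A"
    using iffD1[OF open_contains_ball_eq[OF op], of y] by auto
  have "t = y" if t: "t \<in> fib x" "\<bar>t - y\<bar> < min e ((y - x) / 2)" for t
  proof -
    have "t \<in> ball y e"
      using t(2) by (simp add: dist_real_def abs_minus_commute)
    then have "t \<notin> ?A"
      using e(2) by blast
    moreover have "y - t \<le> (y - x) / 2"
      using t(2) abs_ge_minus_self[of "t - y"] by auto
    then have "t \<ge> x + (y - x) / 2"
      by (simp add: field_simps)
    ultimately show ?thesis
      using t(1) by simp
  qed
  then show ?thesis
    using e(1) pos by (intro exI[of _ "min e ((y - x) / 2)"]) auto
qed

lemma locally_finite_inI:
  assumes "\<Union>\<V> \<subseteq> topspace X"
    and "\<And>x. x \<in> topspace X \<Longrightarrow> \<exists>N. openin X N \<and> x \<in> N \<and> finite {V \<in> \<V>. V \<inter> N \<noteq> {}}"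
  shows "locally_finite_in X \<V>"
  using assms unfolding locally_finite_in_def by blast

lemma locally_finite_in_Un:
  assumes "locally_finite_in X \<A>" "locally_finite_in X \<B>"
  shows "locally_finite_in X (\<A> \<union> \<B>)"
proof (rule locally_finite_inI)
  show "\<Union>(\<A> \<union> \<B>) \<subseteq> topspace X"
    using assms unfolding locally_finite_in_def by auto
  fix x assume x: "x \<in> topspace X"
  obtain M where M: "openin X M" "x \<in> M" "finite {V \<in> \<A>. V \<inter> M \<noteq> {}}"
    using assms(1) x unfolding locally_finite_in_def by blast
  obtain N where N: "openin X N" "x \<in> N" "finite {V \<in> \<B>. V \<inter> N \<noteq> {}}"
    using assms(2) x unfolding locally_finite_in_def by blast
  have "finite {V \<in> \<A> \<union> \<B>. V \<inter> (M \<inter> N) \<noteq> {}}"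
    by (rule finite_subset[OF _ finite_UnI[OF M(3) N(3)]]) auto
  then show "\<exists>N. openin X N \<and> x \<in> N \<and> finite {V \<in> \<A> \<union> \<B>. V \<inter> N \<noteq> {}}"
    using M(1,2) N(1,2) by (intro exI[of _ "M \<inter> N"]) auto
qed

lemma finite_image_meets:
  assumes "finite {i \<in> I. V i \<inter> N \<noteq> {}}"
  shows "finite {A \<in> V ` I. A \<inter> N \<noteq> {}}"
proof -
  have "{A \<in> V ` I. A \<inter> N \<noteq> {}} = V ` {i \<in> I. V i \<inter> N \<noteq> {}}"
    by auto
  then show ?thesis
    using assms by simp
qed

lemma finite_to_nat_on_le:
  assumes "countable A"
  shows "finite {x \<in> A. to_nat_on A x \<le> n}"
proof (rule finite_imageD)
  show "finite (to_nat_on A ` {x \<in> A. to_nat_on A x \<le> n})"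
    by (rule finite_subset[of _ "{..n}"]) auto
  show "inj_on (to_nat_on A) {x \<in> A. to_nat_on A x \<le> n}"
    using inj_on_to_nat_on[OF assms] by (rule inj_on_subset) auto
qed

context fibred
begin

text \<open>
  The points \<open>fib_pt x y\<close> with \<open>y \<noteq> x\<close> are isolated. So it is enough to find a locally finite
  open refinement covering the remaining points of the subspace \<open>Y\<close>, and to add singletons. The
  points over \<open>\<infinity>\<close> are covered by pulling back a locally finite refinement from an open subset
  \<open>G\<close> of the line; it can fail to be locally finite only at points \<open>fib_pt x x\<close> with \<open>x\<close> in the
  frontier of \<open>G\<close>, and there are only countably many of these since \<open>L\<close> is a Luzin set.
\<close>
lemma paracompact_subspace:
  assumes Y: "Y \<subseteq> fibspace L" and Luzin: "\<And>M. meager M \<Longrightarrow> countable (L \<inter> M)"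
  shows "paracompact_space (top_of_set Y)"
  unfolding paracompact_space_def
proof (intro allI impI)
  fix \<U> assume \<U>: "(\<forall>U\<in>\<U>. openin (top_of_set Y) U) \<and> \<Union>\<U> = topspace (top_of_set Y)"
  have box: "openin (top_of_set Y) {v \<in> Y. v 0 \<in> G \<and> (\<forall>x\<in>W. v x = c x)}"
    if W: "finite W" "W \<subseteq> L" and G: "open G" for W G and c :: "real \<Rightarrow> real"
  proof -
    obtain T where "open T" "{v \<in> fibspace L. v 0 \<in> G \<and> (\<forall>x\<in>W. v x = c x)} = fibspace L \<inter> T"
      using openin_fibspace_box[OF W G, of c] unfolding openin_open by blast
    then have "open T" "{v \<in> Y. v 0 \<in> G \<and> (\<forall>x\<in>W. v x = c x)} = Y \<inter> T"
      using Y by blast+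
    then show ?thesis
      unfolding openin_open by blast
  qed
  have level: "openin (top_of_set Y) {v \<in> Y. v 0 \<in> G \<and> v x = 1}" if "x \<in> L" "open G" for x G
    using box[of "{x}" G "\<lambda>_. 1"] that by simp
  have strip: "openin (top_of_set Y) {v \<in> Y. v 0 \<in> G}" if "open G" for G
    using box[of "{}" G "\<lambda>_. 1"] that by simp
  define nbhd where "nbhd u U e W \<longleftrightarrow> U \<in> \<U> \<and> u \<in> U \<and> e > 0 \<and> finite W \<and> W \<subseteq> L \<and>
    (\<forall>v\<in>Y. \<bar>v 0 - u 0\<bar> < e \<longrightarrow> (\<forall>x\<in>W. v x = u x) \<longrightarrow> v \<in> U)" for u U e W
  have "\<exists>U e W. nbhd u U e W" if u: "u \<in> Y" for u
  proof -
    obtain U where U: "U \<in> \<U>" "u \<in> U"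
      using \<U> u by auto
    then obtain T where T: "open T" "U = Y \<inter> T"
      using \<U> unfolding openin_open by blast
    have "openin (top_of_set (fibspace L)) (fibspace L \<inter> T)" "u \<in> fibspace L \<inter> T"
      using T U(2) Y u by (auto simp: openin_open)
    from fibspace_nhd[OF this] obtain e W where eW: "e > 0" "finite W" "W \<subseteq> L"
      "\<forall>v\<in>fibspace L. \<bar>v 0 - u 0\<bar> < e \<longrightarrow> (\<forall>x\<in>W. v x = u x) \<longrightarrow> v \<in> fibspace L \<inter> T"
      by (elim exE conjE)
    then have "\<forall>v\<in>Y. \<bar>v 0 - u 0\<bar> < e \<longrightarrow> (\<forall>x\<in>W. v x = u x) \<longrightarrow> v \<in> U"
      using T(2) Y by blast
    then show ?thesis
      unfolding nbhd_def using U eW(1-3) by (intro exI[of _ U] exI[of _ e] exI[of _ W]) simp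
  qed
  then obtain U\<^sub>0 e\<^sub>0 W\<^sub>0 where nb: "\<And>u. u \<in> Y \<Longrightarrow> nbhd u (U\<^sub>0 u) (e\<^sub>0 u) (W\<^sub>0 u)"
    by metis
  define Z where "Z = {z. base_pt z \<in> Y}"
  define ez where "ez z = e\<^sub>0 (base_pt z)" for z
  define G where "G = (\<Union>z\<in>Z. ball z (ez z))"
  have ez: "ez z > 0" if "z \<in> Z" for z
    using nb[of "base_pt z"] that unfolding Z_def ez_def nbhd_def by simp
  have ZG: "Z \<subseteq> G"
    using ez unfolding G_def by force
  have opG: "open G"
    unfolding G_def by auto
  obtain \<C>\<^sub>0 where C0: "G \<subseteq> \<Union>\<C>\<^sub>0"
    "\<And>U. U \<in> \<C>\<^sub>0 \<Longrightarrow> open U \<and> (\<exists>T. T \<in> (\<lambda>z. ball z (ez z)) ` Z \<and> U \<subseteq> T)"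
    "\<And>x. x \<in> G \<Longrightarrow> \<exists>V. open V \<and> x \<in> V \<and> finite {U. U \<in> \<C>\<^sub>0 \<and> (U \<inter> V \<noteq> {})}"
    by (rule paracompact[of G "(\<lambda>z. ball z (ez z)) ` Z"]) (auto simp: G_def)
  define \<C> where "\<C> = \<C>\<^sub>0 - {{}}"
  have C: "open U" "U \<subseteq> G" "U \<noteq> {}" if "U \<in> \<C>" for U
    using C0(2)[of U] that unfolding \<C>_def G_def by auto
  have GC: "\<exists>U\<in>\<C>. y \<in> U" if "y \<in> G" for y
    using C0(1) that unfolding \<C>_def by blast
  have "\<exists>z. z \<in> Z \<and> U \<subseteq> ball z (ez z)" if "U \<in> \<C>" for U
    using C0(2)[of U] that unfolding \<C>_def by blast
  then obtain c where c: "\<And>U. U \<in> \<C> \<Longrightarrow> c U \<in> Z \<and> U \<subseteq> ball (c U) (ez (c U))"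
    by metis
  have lf: "\<exists>d>0. ball x d \<subseteq> G \<and> finite {U \<in> \<C>. U \<inter> ball x d \<noteq> {}}" if x: "x \<in> G" for x
  proof -
    obtain V where V: "open V" "x \<in> V" "finite {U. U \<in> \<C>\<^sub>0 \<and> (U \<inter> V \<noteq> {})}"
      using C0(3)[OF x] by blast
    have "open (V \<inter> G)" "x \<in> V \<inter> G"
      using V opG x by auto
    then obtain d where d: "d > 0" "ball x d \<subseteq> V \<inter> G"
      using iffD1[OF open_contains_ball_eq] by metis
    have "finite {U \<in> \<C>. U \<inter> ball x d \<noteq> {}}"
      by (rule finite_subset[OF _ V(3)]) (use d(2) in \<open>auto simp: \<C>_def\<close>)
    then show ?thesis
      using d by auto
  qed
  \<comment> \<open>Each member contains a rational, and each rational of \<open>G\<close> lies in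
    finitely many members.\<close>
  have "countable \<C>"
  proof (rule countable_subset)
    show "\<C> \<subseteq> (\<Union>r\<in>\<rat> \<inter> G. {U \<in> \<C>. r \<in> U})"
    proof
      fix U assume U: "U \<in> \<C>"
      then have "interior U \<noteq> {}"
        using C by (simp add: interior_open)
      then have "\<not> U \<subseteq> - \<rat>"
        using C[OF U] Rats_closure_real open_Int_closure_eq_empty[of U \<rat>] by auto
      then obtain r where "r \<in> \<rat>" "r \<in> U"
        by blast
      then show "U \<in> (\<Union>r\<in>\<rat> \<inter> G. {U \<in> \<C>. r \<in> U})"
        using U C(2)[OF U] by blast
    qed
    have "finite {U \<in> \<C>. r \<in> U}" if r: "r \<in> G" for r
    proof -
      obtain d where d: "d > 0" "finite {U \<in> \<C>. U \<inter> ball r d \<noteq> {}}"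
        using lf[OF r] by blast
      show ?thesis
        by (rule finite_subset[OF _ d(2)]) (use d(1) in force)
    qed
    then show "countable (\<Union>r\<in>\<rat> \<inter> G. {U \<in> \<C>. r \<in> U})"
      by (intro countable_UN countable_Int1 countable_rat) (auto intro: countable_finite)
  qed
  define D where "D = L \<inter> frontier G"
  have "countable D"
    unfolding D_def by (intro Luzin nowhere_dense_imp_meager nowhere_dense_frontier opG)
  \<comment> \<open>Besides meeting the demands of the cover, \<open>V U\<close> has to avoid the
    fibres over the points of \<open>D\<close> numbered up to the number of \<open>U\<close>. Hence
    a fibre over a point of \<open>D\<close> meets only finitely many of the sets
    \<open>V U\<close>.\<close>
  define W where "W U = W\<^sub>0 (base_pt (c U)) \<union> {x \<in> D. to_nat_on D x \<le> to_nat_on \<C> U}" for U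
  have W: "finite (W U)" "W U \<subseteq> L" if "U \<in> \<C>" for U
    using nb[of "base_pt (c U)"] c[OF that] finite_to_nat_on_le[OF \<open>countable D\<close>]
    unfolding W_def Z_def nbhd_def D_def by auto
  define V where "V U = {v \<in> Y. v 0 \<in> U \<and> (\<forall>x\<in>W U. v x = 0)}" for U
  have V_open: "openin (top_of_set Y) (V U)" if "U \<in> \<C>" for U
    unfolding V_def using box[OF W[OF that] C(1)[OF that], of "\<lambda>_. 0"] by simp
  have V_sub: "\<exists>T\<in>\<U>. V U \<subseteq> T" if "U \<in> \<C>" for U
  proof -
    have n: "nbhd (base_pt (c U)) (U\<^sub>0 (base_pt (c U))) (ez (c U)) (W\<^sub>0 (base_pt (c U)))"
      using nb[of "base_pt (c U)"] c[OF that] unfolding Z_def ez_def by simp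
    have "v \<in> U\<^sub>0 (base_pt (c U))" if v: "v \<in> V U" for v
    proof -
      have "v \<in> Y" "v 0 \<in> ball (c U) (ez (c U))" "\<forall>x\<in>W\<^sub>0 (base_pt (c U)). v x = 0"
        using v c[OF \<open>U \<in> \<C>\<close>] unfolding V_def W_def by auto
      moreover have "\<forall>x\<in>W\<^sub>0 (base_pt (c U)). base_pt (c U) x = 0"
        using n L_nonzero unfolding nbhd_def by (auto intro!: base_pt_simps(2))
      ultimately show ?thesis
        using n unfolding nbhd_def by (simp add: dist_real_def abs_minus_commute)
    qed
    then show ?thesis
      using n unfolding nbhd_def by blast
  qed
  define \<V>1 where "\<V>1 = V ` \<C>"
  have base_cov: "base_pt z \<in> \<Union>\<V>1" if z: "z \<in> Z" for z
  proof -
    obtain U where U: "U \<in> \<C>" "z \<in> U"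
      using GC ZG z by blast
    then have "base_pt z \<in> V U"
      using z W(2)[OF U(1)] L_nonzero unfolding V_def Z_def by (auto intro!: base_pt_simps(2))
    then show ?thesis
      unfolding \<V>1_def using U(1) by blast
  qed
  have center: "x \<in> W U" if x: "x \<in> L" "fib_pt x x \<in> Y" "fib_pt x x \<notin> \<Union>\<V>1" and U: "U \<in> \<C>" "x \<in> U" for x U
  proof (rule ccontr)
    assume "x \<notin> W U"
    then have "fib_pt x x \<in> V U"
      unfolding V_def using x(2) U(2) L_nonzero x(1) W(2)[OF U(1)] by (auto intro!: fib_pt_simps(3))
    then show False
      using x(3) U(1) unfolding \<V>1_def by blast
  qed
  define E where "E = {x \<in> L. fib_pt x x \<in> Y \<and> fib_pt x x \<notin> \<Union>\<V>1}"
  \<comment> \<open>The uncovered centres in the closure of \<open>G\<close>. There are countably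
    many: each belongs to \<open>D\<close> or, by \<open>center\<close>, to one of the finite sets
    \<open>W U\<close>.\<close>
  define E' where "E' = E \<inter> closure G"
  have "countable E'"
  proof (rule countable_subset)
    show "E' \<subseteq> D \<union> (\<Union>U\<in>\<C>. W U)"
    proof
      fix x assume x: "x \<in> E'"
      show "x \<in> D \<union> (\<Union>U\<in>\<C>. W U)"
      proof (cases "x \<in> G")
        case True
        then obtain U where "U \<in> \<C>" "x \<in> U"
          using GC by blast
        then show ?thesis
          using center[of x U] x unfolding E'_def E_def by blast
      next
        case False
        then show ?thesis
          using x opG unfolding E'_def E_def D_def frontier_def by (simp add: interior_open)
      qed
    qed
    show "countable (D \<union> (\<Union>U\<in>\<C>. W U))"
      using \<open>countable D\<close> \<open>countable \<C>\<close> W(1) by (auto intro: countable_finite)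
  qed
  \<comment> \<open>The radii tend to \<open>0\<close> along an enumeration of \<open>E'\<close>,
    while the balls around the other uncovered centres miss \<open>G\<close>. Both are needed for
    local finiteness at the points over infinity.\<close>
  have "\<exists>r>0. (x \<notin> E' \<longrightarrow> ball x r \<inter> G = {}) \<and> (x \<in> E' \<longrightarrow> r \<le> 1 / real (Suc (to_nat_on E' x)))" if x: "x \<in> E" for x
  proof (cases "x \<in> E'")
    case True
    then show ?thesis
      by (intro exI[of _ "1 / real (Suc (to_nat_on E' x))"]) simp
  next
    case False
    then have "x \<in> - closure G"
      using x unfolding E'_def by blast
    moreover have op: "open (- closure G)"
      by (intro open_Compl closed_closure)
    ultimately obtain r where "r > 0" "ball x r \<subseteq> - closure G"
      using iffD1[OF open_contains_ball_eq[OF op]] by blast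
    then show ?thesis
      using False closure_subset[of G] by (intro exI[of _ r]) auto
  qed
  then obtain \<rho> where \<rho>: "\<And>x. x \<in> E \<Longrightarrow> \<rho> x > 0" "\<And>x. x \<in> E \<Longrightarrow> x \<notin> E' \<Longrightarrow> ball x (\<rho> x) \<inter> G = {}"
      "\<And>x. x \<in> E' \<Longrightarrow> \<rho> x \<le> 1 / real (Suc (to_nat_on E' x))"
    unfolding E'_def by (metis IntD1)
  \<comment> \<open>The condition \<open>v x = 1\<close> fixes all coordinates in \<open>L\<close>,
    so closeness of the first coordinate suffices to stay in a member of the cover.\<close>
  define B where "B x = {v \<in> Y. v 0 \<in> ball x (min (\<rho> x) (e\<^sub>0 (fib_pt x x))) \<and> v x = 1}" for x
  have EL: "x \<in> L" "fib_pt x x \<in> Y" "x \<noteq> 0" if "x \<in> E" for x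
    using that L_nonzero unfolding E_def by auto
  have B_open: "openin (top_of_set Y) (B x)" if "x \<in> E" for x
    unfolding B_def using level[OF EL(1)[OF that]] by blast
  have agree: "v t = fib_pt x x t" if v: "v \<in> Y" "v x = 1" and x: "x \<in> L" "t \<in> L" for v x t
    using fibspace_unique[of v x t] v x Y L_nonzero by (cases "t = x") auto
  have B_sub: "\<exists>T\<in>\<U>. B x \<subseteq> T" if x: "x \<in> E" for x
  proof -
    have n: "nbhd (fib_pt x x) (U\<^sub>0 (fib_pt x x)) (e\<^sub>0 (fib_pt x x)) (W\<^sub>0 (fib_pt x x))"
      using nb EL(2)[OF x] .
    have "v \<in> U\<^sub>0 (fib_pt x x)" if v: "v \<in> B x" for v
    proof -
      have "\<bar>v 0 - fib_pt x x 0\<bar> < e\<^sub>0 (fib_pt x x)"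
        using v EL(3)[OF x] unfolding B_def by (simp add: dist_real_def abs_minus_commute)
      moreover have "\<forall>t\<in>W\<^sub>0 (fib_pt x x). v t = fib_pt x x t"
        using n v agree EL(1)[OF x] unfolding nbhd_def B_def by blast
      ultimately show ?thesis
        using n v unfolding nbhd_def B_def by blast
    qed
    then show ?thesis
      using n unfolding nbhd_def by blast
  qed
  define \<V>2 where "\<V>2 = B ` E"
  define R where "R = \<Union>\<V>1 \<union> \<Union>\<V>2"
  \<comment> \<open>The remaining points are isolated in \<open>Y\<close>.\<close>
  define \<V>3 where "\<V>3 = (\<lambda>v. {v}) ` (Y - R)"
  have fib_case: "\<exists>x\<in>L. u x = 1 \<and> u 0 \<in> fib x" if u: "u \<in> Y" "u 0 \<notin> Z" for u
  proof (rule ccontr)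
    assume neg: "\<not> ?thesis"
    have "u x = 0" if "x \<in> L" for x
      using fibspace_val[of u x] fibspace_fib[of u x] neg that u(1) Y by fastforce
    then have "u = base_pt (u 0)"
      using fibspace_base_pt[of u] u(1) Y by blast
    then show False
      using u unfolding Z_def by simp
  qed
  have isolated: "openin (top_of_set Y) {u}" if u: "u \<in> Y" "x \<in> L" "u x = 1" "u 0 \<noteq> x" for u x
  proof -
    have "u 0 \<in> fib x"
      using fibspace_fib[of u x] u Y by auto
    then obtain e where e: "e > 0" "\<forall>t\<in>fib x. \<bar>t - u 0\<bar> < e \<longrightarrow> t = u 0"
      using fib_isolated u(4) by blast
    have "v = u" if v: "v \<in> Y" "v 0 \<in> ball (u 0) e" "v x = 1" for v
    proof (rule fibspace_ext)
      have "v 0 \<in> fib x"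
        using fibspace_fib[of v x] v u(2) Y by auto
      then show "v 0 = u 0"
        using e(2) v(2) by (simp add: dist_real_def abs_minus_commute)
      show "v t = u t" if "t \<in> L" for t
        using agree[OF v(1,3) u(2) that] agree[OF u(1,3,2) that] by simp
    qed (use v u Y in auto)
    then have "{v \<in> Y. v 0 \<in> ball (u 0) e \<and> v x = 1} = {u}"
      using u e(1) by auto
    then show ?thesis
      using level[OF u(2), of "ball (u 0) e"] by simp
  qed
  have rest: "openin (top_of_set Y) {v}" if v: "v \<in> Y - R" for v
  proof -
    have not_base: "v \<noteq> base_pt z" if "z \<in> Z" for z
      using base_cov[OF that] v unfolding R_def by blast
    have "\<exists>x\<in>L. v x = 1"
    proof (rule ccontr)
      assume "\<not> ?thesis"
      then have "v = base_pt (v 0)"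
        using fibspace_base_pt[of v] fibspace_val[of v] v Y by blast
      moreover from this have "v 0 \<in> Z"
        using v unfolding Z_def by (metis (mono_tags, lifting) DiffD1 mem_Collect_eq)
      ultimately show False
        using not_base by blast
    qed
    then obtain x where x: "x \<in> L" "v x = 1"
      by blast
    have "v 0 \<noteq> x"
    proof
      assume "v 0 = x"
      then have eq: "v = fib_pt x x"
        using fibspace_fib_pt[of v x] x v Y by auto
      then have "x \<in> E"
        using x v unfolding E_def R_def by blast
      then have "v \<in> B x"
        using eq \<rho>(1)[of x] EL(3)[of x] v x nb[of v] unfolding B_def by (simp add: nbhd_def)
      then show False
        using v \<open>x \<in> E\<close> unfolding R_def \<V>2_def by blast
    qed
    then show ?thesis
      using isolated[of v x] v x by blast
  qed
  have R_open: "openin (top_of_set Y) R"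
    unfolding R_def \<V>1_def \<V>2_def using V_open B_open by (intro openin_Un openin_Union) auto
  have sub: "\<Union>\<V>1 \<subseteq> Y" "\<Union>\<V>2 \<subseteq> Y" "\<Union>\<V>3 \<subseteq> Y"
    unfolding \<V>1_def \<V>2_def \<V>3_def V_def B_def by auto
  have lf1: "locally_finite_in (top_of_set Y) \<V>1"
  proof (rule locally_finite_inI)
    fix u assume "u \<in> topspace (top_of_set Y)"
    then have u: "u \<in> Y"
      by simp
    have "\<exists>N. openin (top_of_set Y) N \<and> u \<in> N \<and> finite {U \<in> \<C>. V U \<inter> N \<noteq> {}}"
    proof (cases "u 0 \<in> G")
      case True
      obtain d where d: "d > 0" "finite {U \<in> \<C>. U \<inter> ball (u 0) d \<noteq> {}}"
        using lf[OF True] by blast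
      have "finite {U \<in> \<C>. V U \<inter> {v \<in> Y. v 0 \<in> ball (u 0) d} \<noteq> {}}"
        by (rule finite_subset[OF _ d(2)]) (auto simp: V_def)
      then show ?thesis
        using strip[of "ball (u 0) d"] u d(1) by (intro exI[of _ "{v \<in> Y. v 0 \<in> ball (u 0) d}"]) simp
    next
      case uG: False
      then obtain x where x: "x \<in> L" "u x = 1"
        using fib_case[OF u] ZG by blast
      have u_V: "u \<notin> V U" if "U \<in> \<C>" for U
        using uG C(2)[OF that] unfolding V_def by blast
      show ?thesis
      proof (cases "u 0 \<in> closure G")
        case True
        show ?thesis
        proof (cases "u 0 = x")
          case False
          then have "openin (top_of_set Y) {u}"
            using isolated[OF u x] by blast
          moreover have "{U \<in> \<C>. V U \<inter> {u} \<noteq> {}} = {}"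
            using u_V by auto
          then have "finite {U \<in> \<C>. V U \<inter> {u} \<noteq> {}}"
            by (simp only: finite.emptyI)
          ultimately show ?thesis
            by (intro exI[of _ "{u}"] conjI insertI1)
        next
          case True
          then have xD: "x \<in> D"
            using \<open>u 0 \<in> closure G\<close> uG x(1) opG unfolding D_def frontier_def by (simp add: interior_open)
          \<comment> \<open>As \<open>x\<close> belongs to \<open>D\<close>, any \<open>V U\<close>
            that meets this fibre has a number smaller than that of \<open>x\<close>.\<close>
          let ?N = "{v \<in> Y. v 0 \<in> UNIV \<and> v x = 1}"
          have "finite {U \<in> \<C>. V U \<inter> ?N \<noteq> {}}"
          proof (rule finite_subset[OF _ finite_to_nat_on_le[OF \<open>countable \<C>\<close>, of "to_nat_on D x"]])
            show "{U \<in> \<C>. V U \<inter> ?N \<noteq> {}} \<subseteq> {U \<in> \<C>. to_nat_on \<C> U \<le> to_nat_on D x}"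
            proof
              fix U assume "U \<in> {U \<in> \<C>. V U \<inter> ?N \<noteq> {}}"
              then obtain v where U: "U \<in> \<C>" and v: "v \<in> V U" "v x = 1"
                by auto
              have "x \<notin> W U"
                using v unfolding V_def by auto
              then have "\<not> to_nat_on D x \<le> to_nat_on \<C> U"
                using xD unfolding W_def by simp
              then show "U \<in> {U \<in> \<C>. to_nat_on \<C> U \<le> to_nat_on D x}"
                using U by simp
            qed
          qed
          then show ?thesis
            using level[OF x(1) open_UNIV] u x(2) by (intro exI[of _ ?N]) simp
        qed
      next
        case False
        then have mem: "u 0 \<in> - closure G"
          by simp
        have op: "open (- closure G)"
          by (intro open_Compl closed_closure)
        let ?N = "{v \<in> Y. v 0 \<in> - closure G}"
        have empty: "{U \<in> \<C>. V U \<inter> ?N \<noteq> {}} = {}"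
          using C(2) closure_subset[of G] unfolding V_def by blast
        have "finite {U \<in> \<C>. V U \<inter> ?N \<noteq> {}}"
          unfolding empty by simp
        moreover have "u \<in> ?N"
          using u mem by simp
        ultimately show ?thesis
          using strip[OF op] by (intro exI[of _ ?N] conjI)
      qed
    qed
    then show "\<exists>N. openin (top_of_set Y) N \<and> u \<in> N \<and> finite {A \<in> \<V>1. A \<inter> N \<noteq> {}}"
      unfolding \<V>1_def using finite_image_meets by blast
  qed (use sub in simp)
  have lf2: "locally_finite_in (top_of_set Y) \<V>2"
  proof (rule locally_finite_inI)
    fix u assume "u \<in> topspace (top_of_set Y)"
    then have u: "u \<in> Y"
      by simp
    have "\<exists>N. openin (top_of_set Y) N \<and> u \<in> N \<and> finite {x \<in> E. B x \<inter> N \<noteq> {}}"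
    proof (cases "\<exists>x\<in>L. u x = 1")
      case True
      then obtain x where x: "x \<in> L" "u x = 1"
        by blast
      let ?N = "{v \<in> Y. v 0 \<in> UNIV \<and> v x = 1}"
      have "{t \<in> E. B t \<inter> ?N \<noteq> {}} \<subseteq> {x}"
      proof
        fix t assume "t \<in> {t \<in> E. B t \<inter> ?N \<noteq> {}}"
        then obtain v where "t \<in> L" "v \<in> Y" "v t = 1" "v x = 1"
          using EL(1) unfolding B_def by blast
        then show "t \<in> {x}"
          using fibspace_unique[of v t x] x(1) Y by auto
      qed
      then have "finite {t \<in> E. B t \<inter> ?N \<noteq> {}}"
        by (rule finite_subset) simp
      then show ?thesis
        using level[OF x(1) open_UNIV] u x(2) by (intro exI[of _ ?N]) simp
    next
      case False
      then have "u = base_pt (u 0)"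
        using fibspace_base_pt[of u] fibspace_val[of u] u Y by blast
      then have "u 0 \<in> Z"
        using u unfolding Z_def by simp
      then have "u 0 \<in> G"
        using ZG by blast
      then obtain d where d: "d > 0" "ball (u 0) d \<subseteq> G" "finite {U \<in> \<C>. U \<inter> ball (u 0) d \<noteq> {}}"
        using lf by blast
      let ?N = "{v \<in> Y. v 0 \<in> ball (u 0) (d / 2)}"
      obtain k :: nat where k: "2 / d < real k"
        using reals_Archimedean2 by blast
      \<comment> \<open>If \<open>B x\<close> meets \<open>?N\<close>, it has a point with first
        coordinate in \<open>G\<close>, so \<open>x\<close> lies in \<open>E'\<close>. If the number
        of \<open>x\<close> exceeds \<open>k\<close>, the radius is below \<open>d / 2\<close>, so
        \<open>x\<close> is within \<open>d\<close> of \<open>u 0\<close> and belongs to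
        \<open>W U\<close> for one of the finitely many \<open>U\<close> there.\<close>
      have "{x \<in> E. B x \<inter> ?N \<noteq> {}} \<subseteq> {x \<in> E'. to_nat_on E' x \<le> k} \<union> (\<Union>U\<in>{U \<in> \<C>. U \<inter> ball (u 0) d \<noteq> {}}. W U)"
      proof
        fix x assume "x \<in> {x \<in> E. B x \<inter> ?N \<noteq> {}}"
        then obtain v where x: "x \<in> E" and v: "v \<in> B x" "v 0 \<in> ball (u 0) (d / 2)"
          by blast
        have vx: "v 0 \<in> ball x (\<rho> x)"
          using v(1) unfolding B_def by simp
        have "v 0 \<in> G"
          using v(2) d(1,2) by (auto simp: dist_real_def)
        then have xE': "x \<in> E'"
          using \<rho>(2)[OF x] vx by blast
        show "x \<in> {x \<in> E'. to_nat_on E' x \<le> k} \<union> (\<Union>U\<in>{U \<in> \<C>. U \<inter> ball (u 0) d \<noteq> {}}. W U)"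
        proof (cases "to_nat_on E' x \<le> k")
          case False
          then have "2 / d < real (Suc (to_nat_on E' x))"
            using k by linarith
          then have "1 / real (Suc (to_nat_on E' x)) < d / 2"
            using d(1) by (simp add: field_simps)
          then have "\<rho> x < d / 2"
            using \<rho>(3)[OF xE'] by linarith
          then have xb: "x \<in> ball (u 0) d"
            using vx v(2) unfolding mem_ball dist_real_def by linarith
          then obtain U where U: "U \<in> \<C>" "x \<in> U"
            using GC d(2) by blast
          then have "x \<in> W U"
            using center[of x U] x unfolding E_def by blast
          then show ?thesis
            using U xb by blast
        qed (use xE' in simp)
      qed
      moreover have "finite ({x \<in> E'. to_nat_on E' x \<le> k} \<union> (\<Union>U\<in>{U \<in> \<C>. U \<inter> ball (u 0) d \<noteq> {}}. W U))"
        using finite_to_nat_on_le[OF \<open>countable E'\<close>] d(3) W(1) by auto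
      ultimately have "finite {x \<in> E. B x \<inter> ?N \<noteq> {}}"
        by (rule finite_subset)
      then show ?thesis
        using strip[of "ball (u 0) (d / 2)"] u d(1) by (intro exI[of _ ?N]) simp
    qed
    then show "\<exists>N. openin (top_of_set Y) N \<and> u \<in> N \<and> finite {A \<in> \<V>2. A \<inter> N \<noteq> {}}"
      unfolding \<V>2_def using finite_image_meets by blast
  qed (use sub in simp)
  have lf3: "locally_finite_in (top_of_set Y) \<V>3"
  proof (rule locally_finite_inI)
    fix u assume "u \<in> topspace (top_of_set Y)"
    then have u: "u \<in> Y"
      by simp
    show "\<exists>N. openin (top_of_set Y) N \<and> u \<in> N \<and> finite {A \<in> \<V>3. A \<inter> N \<noteq> {}}"
    proof (cases "u \<in> R")
      case True
      have empty: "{A \<in> \<V>3. A \<inter> R \<noteq> {}} = {}"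
        unfolding \<V>3_def by auto
      show ?thesis
        using R_open True by (intro exI[of _ R]) (simp add: empty)
    next
      case False
      have "{A \<in> \<V>3. A \<inter> {u} \<noteq> {}} \<subseteq> {{u}}"
        unfolding \<V>3_def by auto
      then have "finite {A \<in> \<V>3. A \<inter> {u} \<noteq> {}}"
        by (rule finite_subset) simp
      then show ?thesis
        using rest[of u] u False by (intro exI[of _ "{u}"]) simp
    qed
  qed (use sub in simp)
  show "\<exists>\<V>. (\<forall>A\<in>\<V>. openin (top_of_set Y) A) \<and> \<Union>\<V> = topspace (top_of_set Y) \<and>
      (\<forall>A\<in>\<V>. \<exists>U\<in>\<U>. A \<subseteq> U) \<and> locally_finite_in (top_of_set Y) \<V>"
  proof (intro exI[of _ "\<V>1 \<union> \<V>2 \<union> \<V>3"] conjI)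
    show "locally_finite_in (top_of_set Y) (\<V>1 \<union> \<V>2 \<union> \<V>3)"
      by (intro locally_finite_in_Un lf1 lf2 lf3)
    show "\<forall>A\<in>\<V>1 \<union> \<V>2 \<union> \<V>3. openin (top_of_set Y) A"
      using V_open B_open rest unfolding \<V>1_def \<V>2_def \<V>3_def by blast
    have "Y - R \<subseteq> \<Union>\<V>3"
      unfolding \<V>3_def by auto
    then show "\<Union>(\<V>1 \<union> \<V>2 \<union> \<V>3) = topspace (top_of_set Y)"
      using sub unfolding R_def by auto
    have "\<exists>U\<in>\<U>. A \<subseteq> U" if "A \<in> \<V>3" for A
    proof -
      obtain v where "v \<in> Y" "A = {v}"
        using \<open>A \<in> \<V>3\<close> unfolding \<V>3_def by blast
      then show ?thesis
        using \<U> by auto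
    qed
    then show "\<forall>A\<in>\<V>1 \<union> \<V>2 \<union> \<V>3. \<exists>U\<in>\<U>. A \<subseteq> U"
      using V_sub B_sub unfolding \<V>1_def \<V>2_def by blast
  qed
qed

lemma hereditarily_paracompact_fibspace:
  assumes "\<And>M. meager M \<Longrightarrow> countable (L \<inter> M)"
  shows "hereditarily paracompact_space (top_of_set (fibspace L))"
  unfolding hereditarily_def
proof (intro allI impI)
  fix Y assume "Y \<subseteq> topspace (top_of_set (fibspace L))"
  then have "Y \<subseteq> fibspace L"
    by simp
  then show "paracompact_space (subtopology (top_of_set (fibspace L)) Y)"
    using paracompact_subspace[OF _ assms] by (simp add: subtopology_subtopology inf.absorb2)
qed

end

subsection \<open>The Hilbert space of square summable families\<close>

definition sqsum :: "('i \<Rightarrow> real) \<Rightarrow> bool" where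
  "sqsum f \<longleftrightarrow> (\<lambda>i. (f i)\<^sup>2) summable_on UNIV"

definition nrm2 :: "('i \<Rightarrow> real) \<Rightarrow> real" where
  "nrm2 f = sqrt (\<Sum>\<^sub>\<infinity>i. (f i)\<^sup>2)"

definition ell2 :: "('i \<Rightarrow> real) hspace" where
  "ell2 = \<lparr>vectors = Collect sqsum, vzero = (\<lambda>_. 0), vplus = (\<lambda>f g i. f i + g i),
     vscale = (\<lambda>a f i. a * f i), vinner = (\<lambda>f g. \<Sum>\<^sub>\<infinity>i. f i * g i)\<rparr>"

lemma ell2_simps [simp]: "vectors ell2 = Collect sqsum" "vzero ell2 = (\<lambda>_. 0)"
    "vplus ell2 f g = (\<lambda>i. f i + g i)" "vscale ell2 a f = (\<lambda>i. a * f i)"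
    "vinner ell2 f g = (\<Sum>\<^sub>\<infinity>i. f i * g i)"
  by (simp_all add: ell2_def)

lemma L2_set_le_nrm2: "sqsum f \<Longrightarrow> finite F \<Longrightarrow> L2_set f F \<le> nrm2 f"
  unfolding sqsum_def nrm2_def L2_set_def by (intro real_sqrt_le_mono finite_sum_le_infsum) auto

lemma abs_le_nrm2: "sqsum f \<Longrightarrow> \<bar>f i\<bar> \<le> nrm2 f"
  using L2_set_le_nrm2[of f "{i}"] by simp

lemma nrm2_nonneg: "nrm2 f \<ge> 0"
  by (simp add: nrm2_def infsum_nonneg)

text \<open>Finite partial sums decide both summability and the norm bound, so inequalities and
  limits for \<open>L2_set\<close> carry over to infinite families.\<close>

lemma sqsum_bound:
  assumes "\<And>F. finite F \<Longrightarrow> L2_set f F \<le> c"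
  shows "sqsum f" "nrm2 f \<le> c"
proof -
  have c: "0 \<le> c"
    using assms[of "{}"] by simp
  have le: "(\<Sum>i\<in>F. (f i)\<^sup>2) \<le> c\<^sup>2" if "finite F" for F
    using assms[OF that] unfolding L2_set_def by (rule sqrt_le_D)
  show 1: "sqsum f"
    unfolding sqsum_def by (rule nonneg_bdd_above_summable_on) (auto intro!: bdd_aboveI[of _ "c\<^sup>2"] le)
  have "(\<Sum>\<^sub>\<infinity>i. (f i)\<^sup>2) \<le> c\<^sup>2"
    using 1 le unfolding sqsum_def by (intro infsum_le_finite_sums)
  then show "nrm2 f \<le> c"
    unfolding nrm2_def using c by (simp add: real_le_lsqrt infsum_nonneg)
qed

lemma sqsum_add:
  assumes "sqsum f" "sqsum g"
  shows "sqsum (\<lambda>i. f i + g i)" "nrm2 (\<lambda>i. f i + g i) \<le> nrm2 f + nrm2 g"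
proof -
  have "L2_set (\<lambda>i. f i + g i) F \<le> nrm2 f + nrm2 g" if "finite F" for F
    using L2_set_triangle_ineq[of f g F] L2_set_le_nrm2[OF assms(1) that] L2_set_le_nrm2[OF assms(2) that] by linarith
  then show "sqsum (\<lambda>i. f i + g i)" "nrm2 (\<lambda>i. f i + g i) \<le> nrm2 f + nrm2 g"
    using sqsum_bound[of "\<lambda>i. f i + g i" "nrm2 f + nrm2 g"] by blast+
qed

lemma sqsum_scale: "sqsum f \<Longrightarrow> sqsum (\<lambda>i. a * f i)"
  unfolding sqsum_def by (simp add: power_mult_distrib summable_on_cmult_right)

lemma sqsum_diff: "sqsum f \<Longrightarrow> sqsum g \<Longrightarrow> sqsum (\<lambda>i. f i - g i)"
  using sqsum_add(1)[of f "\<lambda>i. - 1 * g i"] sqsum_scale[of g "- 1"] by simp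

lemma nrm2_minus: "nrm2 (\<lambda>i. f i - g i) = nrm2 (\<lambda>i. g i - f i)"
  unfolding nrm2_def by (simp add: power2_commute)

lemma nrm2_eq_0: "sqsum f \<Longrightarrow> nrm2 f = 0 \<Longrightarrow> f i = 0"
  using abs_le_nrm2[of f i] by simp

text \<open>Polarization: the product is a combination of three summable squares.\<close>

lemma summable_on_prod:
  assumes "sqsum f" "sqsum g"
  shows "(\<lambda>i. f i * g i) summable_on UNIV"
proof -
  have "(\<lambda>i. (1/2) * ((f i + g i)\<^sup>2 + - 1 * ((f i)\<^sup>2 + (g i)\<^sup>2))) summable_on UNIV"
    using assms sqsum_add(1)[OF assms] unfolding sqsum_def
    by (intro summable_on_cmult_right summable_on_add)
  moreover have "(1/2) * ((f i + g i)\<^sup>2 + - 1 * ((f i)\<^sup>2 + (g i)\<^sup>2)) = f i * g i" for i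
    by (simp add: power2_sum)
  ultimately show ?thesis
    by simp
qed

lemma vnorm_ell2: "vnorm ell2 f = nrm2 f"
  by (simp add: vnorm_def nrm2_def power2_eq_square)

lemma vdist_ell2: "vdist ell2 f g = nrm2 (\<lambda>i. f i - g i)"
  by (simp add: vdist_def vnorm_ell2)

lemma Metric_space_ell2: "Metric_space (vectors ell2) (vdist ell2)"
proof
  fix f g h :: "'a \<Rightarrow> real"
  show "0 \<le> vdist ell2 f g" "vdist ell2 f g = vdist ell2 g f"
    by (simp_all add: vdist_ell2 nrm2_nonneg nrm2_minus[of f g])
  assume fg: "f \<in> vectors ell2" "g \<in> vectors ell2"
  show "vdist ell2 f g = 0 \<longleftrightarrow> f = g"
    using nrm2_eq_0[of "\<lambda>i. f i - g i"] sqsum_diff[of f g] fg by (auto simp: vdist_ell2 nrm2_def)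
  assume h: "h \<in> vectors ell2"
  show "vdist ell2 f h \<le> vdist ell2 f g + vdist ell2 g h"
    using sqsum_add(2)[of "\<lambda>i. f i - g i" "\<lambda>i. g i - h i"] sqsum_diff[of f g] sqsum_diff[of g h] fg h by (simp add: vdist_ell2)
qed

text \<open>A Cauchy sequence converges in each coordinate. The Cauchy estimate passes to the limit
  on every finite set of indices and then, by \<open>sqsum_bound\<close>, to the whole
  family.\<close>

lemma mcomplete_ell2: "Metric_space.mcomplete (vectors ell2) (vdist ell2)"
proof -
  interpret Metric_space "vectors ell2" "vdist ell2 :: ('a \<Rightarrow> real) \<Rightarrow> _"
    by (rule Metric_space_ell2)
  show ?thesis
    unfolding mcomplete_def
  proof (intro allI impI)
    fix \<sigma> :: "nat \<Rightarrow> 'a \<Rightarrow> real"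
    assume "MCauchy \<sigma>"
    then have sq: "sqsum (\<sigma> n)" and cau: "\<And>e. e > 0 \<Longrightarrow> \<exists>N. \<forall>n n'. N \<le> n \<longrightarrow> N \<le> n' \<longrightarrow> nrm2 (\<lambda>i. \<sigma> n i - \<sigma> n' i) < e" for n
      unfolding MCauchy_def by (auto simp: vdist_ell2)
    have "Cauchy (\<lambda>n. \<sigma> n i)" for i
    proof (rule metric_CauchyI)
      fix e :: real assume "e > 0"
      from cau[OF this] obtain N where "\<forall>n n'. N \<le> n \<longrightarrow> N \<le> n' \<longrightarrow> nrm2 (\<lambda>i. \<sigma> n i - \<sigma> n' i) < e"
        by blast
      then have "dist (\<sigma> m i) (\<sigma> n i) < e" if "m \<ge> N" "n \<ge> N" for m n
        using abs_le_nrm2[OF sqsum_diff[OF sq[of m] sq[of n]], of i] that unfolding dist_real_def by fastforce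
      then show "\<exists>M. \<forall>m\<ge>M. \<forall>n\<ge>M. dist (\<sigma> m i) (\<sigma> n i) < e"
        by blast
    qed
    then have "\<exists>l. (\<lambda>n. \<sigma> n i) \<longlonglongrightarrow> l" for i
      using Cauchy_convergent convergent_def by blast
    then obtain h where h: "\<And>i. (\<lambda>n. \<sigma> n i) \<longlonglongrightarrow> h i"
      by metis
    have bound: "sqsum (\<lambda>i. \<sigma> n i - h i) \<and> nrm2 (\<lambda>i. \<sigma> n i - h i) \<le> e"
      if N: "\<And>n n'. N \<le> n \<Longrightarrow> N \<le> n' \<Longrightarrow> nrm2 (\<lambda>i. \<sigma> n i - \<sigma> n' i) < e" and n: "n \<ge> N" for N n e
    proof -
      have "L2_set (\<lambda>i. \<sigma> n i - h i) F \<le> e" if "finite F" for F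
      proof (rule LIMSEQ_le_const2)
        show "(\<lambda>k. L2_set (\<lambda>i. \<sigma> n i - \<sigma> k i) F) \<longlonglongrightarrow> L2_set (\<lambda>i. \<sigma> n i - h i) F"
          unfolding L2_set_def by (intro tendsto_intros h)
        have "L2_set (\<lambda>i. \<sigma> n i - \<sigma> k i) F \<le> e" if "k \<ge> N" for k
          using L2_set_le_nrm2[OF sqsum_diff[OF sq[of n] sq[of k]] \<open>finite F\<close>] N[OF n that] by linarith
        then show "\<exists>M. \<forall>k\<ge>M. L2_set (\<lambda>i. \<sigma> n i - \<sigma> k i) F \<le> e"
          by blast
      qed
      then show ?thesis
        using sqsum_bound by blast
    qed
    obtain N1 where "\<forall>n n'. N1 \<le> n \<longrightarrow> N1 \<le> n' \<longrightarrow> nrm2 (\<lambda>i. \<sigma> n i - \<sigma> n' i) < 1"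
      using cau[of 1] by auto
    then have "sqsum (\<lambda>i. \<sigma> N1 i - h i)"
      using bound[of N1 1 N1] by auto
    then have sqh: "sqsum h"
      using sqsum_diff[OF sq[of N1]] by fastforce
    show "\<exists>h. limitin mtopology \<sigma> h sequentially"
    proof (intro exI[of _ h], unfold limit_metric_sequentially, intro conjI allI impI)
      show "h \<in> vectors ell2"
        using sqh by simp
      fix e :: real assume "e > 0"
      then obtain N where N: "\<forall>n n'. N \<le> n \<longrightarrow> N \<le> n' \<longrightarrow> nrm2 (\<lambda>i. \<sigma> n i - \<sigma> n' i) < e / 2"
        using cau[of "e / 2"] by auto
      have "nrm2 (\<lambda>i. \<sigma> n i - h i) < e" if "n \<ge> N" for n
        using bound[of N "e / 2" n] N that \<open>e > 0\<close> by auto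
      then show "\<exists>N. \<forall>n\<ge>N. \<sigma> n \<in> vectors ell2 \<and> vdist ell2 (\<sigma> n) h < e"
        using sq by (intro exI[of _ N]) (simp add: vdist_ell2)
    qed
  qed
qed

lemma real_hilbert_space_ell2: "real_hilbert_space ell2"
proof
  fix f g h :: "'a \<Rightarrow> real" and a b :: real
  show "vzero ell2 \<in> (vectors ell2 :: ('a \<Rightarrow> real) set)"
    by (simp add: sqsum_def)
  show "Metric_space.mcomplete (vectors ell2) (vdist (ell2 :: ('a \<Rightarrow> real) hspace))"
    by (rule mcomplete_ell2)
  assume f: "f \<in> vectors ell2"
  then have sf: "sqsum f"
    by simp
  show "vscale ell2 a f \<in> vectors ell2"
    using sf sqsum_scale by simp
  show "\<exists>g\<in>vectors ell2. vplus ell2 f g = vzero ell2"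
    using sqsum_scale[OF sf, of "- 1"] by (intro bexI[of _ "\<lambda>i. - 1 * f i"]) auto
  show "0 \<le> vinner ell2 f f"
    by (simp add: infsum_nonneg)
  show "vplus ell2 f (vzero ell2) = f" "vscale ell2 1 f = f"
    "vscale ell2 (a + b) f = vplus ell2 (vscale ell2 a f) (vscale ell2 b f)"
    "vscale ell2 a (vscale ell2 b f) = vscale ell2 (a * b) f"
    by (simp_all add: algebra_simps)
  show "f = vzero ell2" if "vinner ell2 f f = 0"
  proof -
    have "nrm2 f = 0"
      using that by (simp add: nrm2_def power2_eq_square)
    then show ?thesis
      using nrm2_eq_0[OF sf] by auto
  qed
  assume g: "g \<in> vectors ell2"
  then have sg: "sqsum g"
    by simp
  show "vplus ell2 f g \<in> vectors ell2"
    using sqsum_add(1) sf sg by simp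
  show "vplus ell2 f g = vplus ell2 g f" "vinner ell2 f g = vinner ell2 g f"
    "vscale ell2 a (vplus ell2 f g) = vplus ell2 (vscale ell2 a f) (vscale ell2 a g)"
    by (simp_all add: algebra_simps)
  show "vinner ell2 (vscale ell2 a f) g = a * vinner ell2 f g"
    using infsum_cmult_right'[of a "\<lambda>i. f i * g i" UNIV] by (simp add: mult.assoc)
  assume h: "h \<in> vectors ell2"
  then have sh: "sqsum h"
    by simp
  show "vplus ell2 (vplus ell2 f g) h = vplus ell2 f (vplus ell2 g h)"
    by (simp add: algebra_simps)
  show "vinner ell2 (vplus ell2 f g) h = vinner ell2 f h + vinner ell2 g h"
    using infsum_add[OF summable_on_prod[OF sf sh] summable_on_prod[OF sg sh]] by (simp add: distrib_right)
qed

section \<open>Continuous functionals and the weak topology of the Hilbert space\<close>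

definition unit_vec :: "'i \<Rightarrow> 'i \<Rightarrow> real" where
  "unit_vec j = (\<lambda>i. if i = j then 1 else 0)"

lemma sqsum_finite_support:
  assumes "finite T" "\<And>i. i \<notin> T \<Longrightarrow> f i = 0"
  shows "sqsum f" "(\<Sum>\<^sub>\<infinity>i. (f i)\<^sup>2) = (\<Sum>i\<in>T. (f i)\<^sup>2)"
proof -
  have "(\<lambda>i. (f i)\<^sup>2) summable_on UNIV \<longleftrightarrow> (\<lambda>i. (f i)\<^sup>2) summable_on T"
    by (rule summable_on_cong_neutral) (use assms in auto)
  then show "sqsum f"
    unfolding sqsum_def using assms(1) by simp
  have "(\<Sum>\<^sub>\<infinity>i. (f i)\<^sup>2) = (\<Sum>\<^sub>\<infinity>i\<in>T. (f i)\<^sup>2)"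
    by (rule infsum_cong_neutral) (use assms in auto)
  then show "(\<Sum>\<^sub>\<infinity>i. (f i)\<^sup>2) = (\<Sum>i\<in>T. (f i)\<^sup>2)"
    using assms(1) by simp
qed

lemma functional_finite_support:
  assumes \<phi>: "continuous_functional ell2 \<phi>" and "finite T"
  shows "\<phi> (\<lambda>i. if i \<in> T then c i else 0) = (\<Sum>i\<in>T. c i * \<phi> (unit_vec i))"
  using assms(2)
proof (induction T rule: finite_induct)
  case empty
  have "\<forall>a. \<forall>f\<in>vectors ell2. \<phi> (vscale ell2 a f) = a * \<phi> f"
    using \<phi> unfolding continuous_functional_def by blast
  from this[rule_format, of "\<lambda>_. 0" 0] show ?case
    by (simp add: sqsum_def)
next
  case (insert j T)
  let ?f = "\<lambda>i. if i \<in> T then c i else 0"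
  have sq: "sqsum ?f" "sqsum (unit_vec j)"
    using sqsum_finite_support(1)[of T ?f] sqsum_finite_support(1)[of "{j}" "unit_vec j"] insert(1)
    by (auto simp: unit_vec_def)
  have "(\<lambda>i. if i \<in> insert j T then c i else 0) = vplus ell2 (vscale ell2 (c j) (unit_vec j)) ?f"
    using insert(2) by (auto simp: unit_vec_def)
  then have "\<phi> (\<lambda>i. if i \<in> insert j T then c i else 0) = c j * \<phi> (unit_vec j) + \<phi> ?f"
    using \<phi> sq sqsum_scale[OF sq(2)] unfolding continuous_functional_def by simp
  then show ?case
    using insert by simp
qed

text \<open>Evaluating \<open>\<phi>\<close> at the vector whose coefficients are its own values on
  \<open>T\<close> gives \<open>s \<le> K * sqrt s\<close> for the sum \<open>s\<close> of their
  squares. So \<open>s\<close> is at most \<open>K\<^sup>2\<close>, which bounds the number of large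
  values.\<close>

lemma functional_finite_large:
  assumes \<phi>: "continuous_functional ell2 \<phi>" and "\<epsilon> > 0"
  shows "finite {i. \<bar>\<phi> (unit_vec i)\<bar> > \<epsilon>}"
proof (rule ccontr)
  assume inf: "infinite {i. \<bar>\<phi> (unit_vec i)\<bar> > \<epsilon>}"
  obtain K where K: "\<And>f. sqsum f \<Longrightarrow> \<bar>\<phi> f\<bar> \<le> K * nrm2 f"
    using \<phi> unfolding continuous_functional_def vnorm_ell2 by auto
  obtain N :: nat where N: "K\<^sup>2 / \<epsilon>\<^sup>2 < real N"
    using reals_Archimedean2 by blast
  obtain T where T: "finite T" "card T = N" "T \<subseteq> {i. \<bar>\<phi> (unit_vec i)\<bar> > \<epsilon>}"
    using infinite_arbitrarily_large[OF inf] by blast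
  define s where "s = (\<Sum>i\<in>T. (\<phi> (unit_vec i))\<^sup>2)"
  let ?f = "\<lambda>i. if i \<in> T then \<phi> (unit_vec i) else 0"
  have "(\<Sum>\<^sub>\<infinity>i. (?f i)\<^sup>2) = (\<Sum>i\<in>T. (?f i)\<^sup>2)"
    by (rule sqsum_finite_support(2)) (use T(1) in auto)
  then have "nrm2 ?f = sqrt s"
    unfolding nrm2_def s_def by simp
  moreover have "\<phi> ?f = s"
    unfolding functional_finite_support[OF \<phi> T(1)] s_def by (simp add: power2_eq_square)
  moreover have "sqsum ?f"
    by (rule sqsum_finite_support(1)[OF T(1)]) simp
  ultimately have "\<bar>s\<bar> \<le> K * sqrt s"
    using K by metis
  moreover have s0: "s \<ge> 0"
    unfolding s_def by (simp add: sum_nonneg)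
  ultimately have "sqrt s * sqrt s \<le> K * sqrt s"
    by simp
  have lower: "real N * \<epsilon>\<^sup>2 \<le> s"
  proof -
    have "\<epsilon>\<^sup>2 \<le> (\<phi> (unit_vec i))\<^sup>2" if "i \<in> T" for i
      using T(3) that assms(2) by (intro abs_le_square_iff[THEN iffD1]) auto
    then have "(\<Sum>i\<in>T. \<epsilon>\<^sup>2) \<le> s"
      unfolding s_def by (rule sum_mono)
    then show ?thesis
      using T(2) by simp
  qed
  have "K\<^sup>2 < real N * \<epsilon>\<^sup>2"
    using N assms(2) by (simp add: field_simps)
  then have "K\<^sup>2 < s"
    using lower by linarith
  then have "s > 0"
    by (meson le_less_trans zero_le_power2)
  then have "sqrt s \<le> K"
    using \<open>sqrt s * sqrt s \<le> K * sqrt s\<close> by (intro mult_right_le_imp_le[of "sqrt s" "sqrt s" K]) auto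
  then have "s \<le> K\<^sup>2"
    using s0 by (simp add: sqrt_le_D)
  then show False
    using \<open>K\<^sup>2 < s\<close> by simp
qed

lemma continuous_functional_coord: "continuous_functional ell2 (\<lambda>f. f i)"
  unfolding continuous_functional_def vnorm_ell2
  using abs_le_nrm2 by (auto intro!: exI[of _ 1])

lemma topspace_weak_ell2: "topspace (weak_topology ell2) = Collect sqsum"
proof
  show "topspace (weak_topology ell2) \<subseteq> (Collect sqsum :: ('a \<Rightarrow> real) set)"
    unfolding weak_topology_def by auto
  have "openin (weak_topology ell2) {f \<in> vectors ell2. f undefined \<in> (UNIV :: real set)}"
    unfolding weak_topology_def
    by (rule topology_generated_by_Basis)
       (intro CollectI exI[of _ "\<lambda>h. h undefined"] exI[of _ UNIV] conjI refl continuous_functional_coord open_UNIV)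
  then show "(Collect sqsum :: ('a \<Rightarrow> real) set) \<subseteq> topspace (weak_topology ell2)"
    using openin_subset by fastforce
qed

text \<open>The coordinates are continuous functionals and separate points.\<close>

lemma Hausdorff_weak_ell2: "Hausdorff_space (weak_topology ell2)"
  unfolding Hausdorff_space_def topspace_weak_ell2
proof (intro allI impI)
  fix f g :: "'a \<Rightarrow> real"
  assume fg: "f \<in> Collect sqsum \<and> g \<in> Collect sqsum \<and> f \<noteq> g"
  then obtain i where "f i \<noteq> g i"
    by blast
  then obtain U V where UV: "open U" "open V" "f i \<in> U" "g i \<in> V" "U \<inter> V = {}"
    using hausdorff[OF \<open>f i \<noteq> g i\<close>] by blast
  have "openin (weak_topology ell2) {h \<in> vectors ell2. h i \<in> U}" if "open U" for U
    unfolding weak_topology_def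
    by (rule topology_generated_by_Basis)
       (intro CollectI exI[of _ "\<lambda>h. h i"] exI[of _ U] conjI refl continuous_functional_coord that)
  then show "\<exists>U V. openin (weak_topology ell2) U \<and> openin (weak_topology ell2) V \<and> f \<in> U \<and> g \<in> V \<and> disjnt U V"
    using UV fg
    by (intro exI[of _ "{h \<in> vectors ell2. h i \<in> U}"] exI[of _ "{h \<in> vectors ell2. h i \<in> V}"])
       (auto simp: disjnt_def)
qed

context fibred
begin

text \<open>A point is sent to the family of its coordinates. At a point over \<open>x\<close>, a
  continuous functional is a multiple of the first coordinate plus a constant \<open>a x\<close>,
  and \<open>\<bar>a x\<bar>\<close> exceeds a given positive bound for finitely many
  \<open>x\<close> only. This yields weak continuity; an injective continuous map from a compact
  space to a Hausdorff space is an embedding.\<close>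

lemma uniform_Eberlein_compact_fibspace: "uniform_Eberlein_compact (top_of_set (fibspace L))"
proof -
  \<comment> \<open>The vectors have to be functions on the type of the points of the space, so the
    index \<open>t\<close> is encoded as the constant function with value \<open>t\<close>.\<close>
  define \<kappa> :: "real \<Rightarrow> real \<Rightarrow> real" where "\<kappa> t = (\<lambda>_. t)" for t
  define F :: "(real \<Rightarrow> real) \<Rightarrow> (real \<Rightarrow> real) \<Rightarrow> real" where
    "F u = (\<lambda>i. if i \<in> range \<kappa> then u (i 0) else 0)" for u
  have inj_\<kappa>: "inj \<kappa>"
    unfolding \<kappa>_def by (intro injI) metis
  have F\<kappa>: "F u (\<kappa> t) = u t" for u t
    unfolding F_def \<kappa>_def by auto
  have F_eq: "F u = (\<lambda>i. if i \<in> \<kappa> ` T then F u i else 0)" if "\<And>t. t \<notin> T \<Longrightarrow> u t = 0" for u T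
    using that unfolding F_def \<kappa>_def by fastforce
  have supp: "\<exists>T. finite T \<and> (\<forall>t. t \<notin> T \<longrightarrow> u t = 0)" if "u \<in> fibspace L" for u
    using that
  proof (cases rule: fibspace_cases)
    case (base y)
    then show ?thesis
      by (intro exI[of _ "{0}"]) (auto simp: base_pt_def)
  next
    case (fib x y)
    then show ?thesis
      by (intro exI[of _ "{0, x}"]) (auto simp: fib_pt_def)
  qed
  have sq: "sqsum (F u)" if u: "u \<in> fibspace L" for u
  proof -
    obtain T where T: "finite T" "\<And>t. t \<notin> T \<Longrightarrow> u t = 0"
      using supp[OF u] by blast
    show ?thesis
      by (rule sqsum_finite_support(1)[of "\<kappa> ` T"]) (use T F_eq[of T u] in \<open>auto, metis\<close>)
  qed
  have val: "\<phi> (F u) = (\<Sum>t\<in>T. u t * \<phi> (unit_vec (\<kappa> t)))"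
    if \<phi>: "continuous_functional ell2 \<phi>" and T: "finite T" "\<And>t. t \<notin> T \<Longrightarrow> u t = 0" for \<phi> u T
  proof -
    have "\<phi> (F u) = \<phi> (\<lambda>i. if i \<in> \<kappa> ` T then F u i else 0)"
      using F_eq[OF T(2)] by simp
    also have "\<dots> = (\<Sum>i\<in>\<kappa> ` T. F u i * \<phi> (unit_vec i))"
      using T(1) by (intro functional_finite_support[OF \<phi>]) simp
    also have "\<dots> = (\<Sum>t\<in>T. u t * \<phi> (unit_vec (\<kappa> t)))"
      using inj_\<kappa> by (subst sum.reindex) (auto simp: F\<kappa> inj_on_def)
    finally show ?thesis .
  qed
  have val_base: "\<phi> (F u) = u 0 * \<phi> (unit_vec (\<kappa> 0))"
    if \<phi>: "continuous_functional ell2 \<phi>" and u: "u \<in> fibspace L" "\<And>x. x \<in> L \<Longrightarrow> u x = 0" for \<phi> u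
    using val[OF \<phi>, of "{0}" u] fibspace_outside[OF u(1)] u(2) by auto
  have val_fib: "\<phi> (F u) = u 0 * \<phi> (unit_vec (\<kappa> 0)) + \<phi> (unit_vec (\<kappa> x))"
    if \<phi>: "continuous_functional ell2 \<phi>" and u: "u \<in> fibspace L" "x \<in> L" "u x \<noteq> 0" for \<phi> u x
  proof -
    have "u t = 0" if "t \<notin> {0, x}" for t
      using that fibspace_outside[OF u(1)] fibspace_unique[OF u(1,2) _ u(3)] by auto
    moreover have "u x = 1"
      using fibspace_val[OF u(1,2)] u(3) by simp
    ultimately show ?thesis
      using val[OF \<phi>, of "{0, x}" u] L_nonzero[OF u(2)] by simp
  qed
  have "continuous_map (top_of_set (fibspace L)) (weak_topology ell2) F"
    unfolding weak_topology_def
  proof (rule continuous_on_generated_topo)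
    fix V assume "V \<in> {{x \<in> vectors ell2. \<phi> x \<in> U} |(\<phi> :: ((real \<Rightarrow> real) \<Rightarrow> real) \<Rightarrow> real) U. continuous_functional ell2 \<phi> \<and> open U}"
    then obtain \<phi> U where V: "V = {x \<in> vectors ell2. \<phi> x \<in> U}" and \<phi>: "continuous_functional ell2 \<phi>" and U: "open U"
      by blast
    define a where "a t = \<phi> (unit_vec (\<kappa> t))" for t
    have "openin (top_of_set (fibspace L)) {u \<in> fibspace L. \<phi> (F u) \<in> U}"
    proof (subst openin_subopen, intro ballI)
      fix u assume "u \<in> {u \<in> fibspace L. \<phi> (F u) \<in> U}"
      then have u: "u \<in> fibspace L" "\<phi> (F u) \<in> U"
        by auto
      obtain \<epsilon> where \<epsilon>: "\<epsilon> > 0" "ball (\<phi> (F u)) \<epsilon> \<subseteq> U"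
        using iffD1[OF open_contains_ball_eq[OF U] u(2)] by auto
      \<comment> \<open>Agreement on the support of \<open>u\<close> preserves the term of
        \<open>u\<close> itself, and agreement at the indices with large \<open>a x\<close> limits
        any new term to \<open>\<epsilon> / 2\<close>.\<close>
      define W where "W = L \<inter> ({x. u x \<noteq> 0} \<union> {x. \<bar>a x\<bar> > \<epsilon> / 2})"
      have "finite {x. \<bar>a x\<bar> > \<epsilon> / 2}"
      proof -
        have "finite (\<kappa> -` {i. \<bar>\<phi> (unit_vec i)\<bar> > \<epsilon> / 2})"
          using \<epsilon>(1) by (intro finite_vimageI functional_finite_large[OF \<phi>] inj_\<kappa>) simp
        then show ?thesis
          by (simp add: a_def vimage_def)
      qed
      moreover have "finite {x. u x \<noteq> 0}"
        using supp[OF u(1)] by (metis (mono_tags, lifting) finite_subset mem_Collect_eq subsetI)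
      ultimately have W: "finite W" "W \<subseteq> L"
        unfolding W_def by auto
      \<comment> \<open>The first coordinate gets the other half of the tolerance; adding
        \<open>1\<close> keeps the denominator positive when \<open>a 0 = 0\<close>.\<close>
      define d where "d = \<epsilon> / 2 / (\<bar>a 0\<bar> + 1)"
      have d: "d > 0" "d * \<bar>a 0\<bar> \<le> \<epsilon> / 2"
        using \<epsilon>(1) unfolding d_def by (auto simp: field_simps)
      let ?N = "{v \<in> fibspace L. v 0 \<in> ball (u 0) d \<and> (\<forall>x\<in>W. v x = u x)}"
      have close: "\<bar>\<phi> (F v) - \<phi> (F u)\<bar> < \<epsilon>" if v: "v \<in> ?N" for v
      proof -
        have vS: "v \<in> fibspace L" and v0: "\<bar>v 0 - u 0\<bar> < d" and vW: "\<And>x. x \<in> W \<Longrightarrow> v x = u x"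
          using v by (auto simp: dist_real_def abs_minus_commute)
        have "\<bar>(v 0 - u 0) * a 0\<bar> \<le> d * \<bar>a 0\<bar>"
          using v0 unfolding abs_mult by (intro mult_right_mono) auto
        then have le: "\<bar>v 0 * a 0 - u 0 * a 0\<bar> \<le> \<epsilon> / 2"
          using d(2) by (simp add: left_diff_distrib)
        show ?thesis
        proof (cases "\<exists>x\<in>L. u x \<noteq> 0")
          case True
          then obtain x where x: "x \<in> L" "u x \<noteq> 0"
            by blast
          then have "v x \<noteq> 0"
            using vW[of x] unfolding W_def by auto
          then show ?thesis
            using val_fib[OF \<phi> vS x(1)] val_fib[OF \<phi> u(1) x] le \<epsilon>(1) unfolding a_def by simp
        next
          case False
          then have ub: "\<phi> (F u) = u 0 * a 0"
            using val_base[OF \<phi> u(1)] unfolding a_def by blast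
          show ?thesis
          proof (cases "\<exists>x\<in>L. v x \<noteq> 0")
            case True
            then obtain x where x: "x \<in> L" "v x \<noteq> 0"
              by blast
            then have "x \<notin> W"
              using vW[of x] False by auto
            then have "\<bar>a x\<bar> \<le> \<epsilon> / 2"
              using x(1) unfolding W_def by auto
            moreover have "\<bar>v 0 * a 0 - u 0 * a 0\<bar> < \<epsilon> / 2"
            proof -
              have "\<bar>v 0 - u 0\<bar> * \<bar>a 0\<bar> < \<epsilon> / 2"
              proof (cases "a 0 = 0")
                case False
                then have "\<bar>v 0 - u 0\<bar> * \<bar>a 0\<bar> < d * \<bar>a 0\<bar>"
                  using v0 by (intro mult_strict_right_mono) auto
                then show ?thesis
                  using d(2) by linarith
              qed (use \<epsilon>(1) in simp)
              then show ?thesis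
                by (simp add: left_diff_distrib flip: abs_mult)
            qed
            ultimately show ?thesis
              using val_fib[OF \<phi> vS x] ub unfolding a_def[symmetric] by linarith
          next
            case False
            then have "\<phi> (F v) = v 0 * a 0"
              using val_base[OF \<phi> vS] unfolding a_def by blast
            then show ?thesis
              using ub le \<epsilon>(1) by simp
          qed
        qed
      qed
      have "openin (top_of_set (fibspace L)) ?N"
        using W by (intro openin_fibspace_box) auto
      moreover have "u \<in> ?N"
        using u(1) d(1) by simp
      moreover have "?N \<subseteq> {u \<in> fibspace L. \<phi> (F u) \<in> U}"
      proof
        fix v assume v: "v \<in> ?N"
        then have "\<phi> (F v) \<in> ball (\<phi> (F u)) \<epsilon>"
          using close[OF v] by (simp add: dist_real_def abs_minus_commute)
        then show "v \<in> {u \<in> fibspace L. \<phi> (F u) \<in> U}"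
          using v \<epsilon>(2) by blast
      qed
      ultimately show "\<exists>T. openin (top_of_set (fibspace L)) T \<and> u \<in> T \<and> T \<subseteq> {u \<in> fibspace L. \<phi> (F u) \<in> U}"
        by (intro exI[of _ ?N]) simp
    qed
    moreover have "F -` V \<inter> topspace (top_of_set (fibspace L)) = {u \<in> fibspace L. \<phi> (F u) \<in> U}"
      unfolding V using sq by auto
    ultimately show "openin (top_of_set (fibspace L)) (F -` V \<inter> topspace (top_of_set (fibspace L)))"
      by simp
  next
    have "\<Union>{{x \<in> vectors ell2. \<phi> x \<in> U} |(\<phi> :: ((real \<Rightarrow> real) \<Rightarrow> real) \<Rightarrow> real) U. continuous_functional ell2 \<phi> \<and> open U} = Collect sqsum"
      using topspace_weak_ell2 unfolding weak_topology_def topology_generated_by_topspace .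
    then show "F ` topspace (top_of_set (fibspace L)) \<subseteq> \<Union>{{x \<in> vectors ell2. \<phi> x \<in> U} |(\<phi> :: ((real \<Rightarrow> real) \<Rightarrow> real) \<Rightarrow> real) U. continuous_functional ell2 \<phi> \<and> open U}"
      using sq by (simp only: topspace_euclidean_subtopology) blast
  qed
  moreover have "compact_space (top_of_set (fibspace L))"
    by (simp add: compact_space_subtopology compact_fibspace)
  moreover have "inj_on F (topspace (top_of_set (fibspace L)))"
    by (intro inj_onI ext) (metis F\<kappa>)
  ultimately have "embedding_map (top_of_set (fibspace L)) (weak_topology ell2) F"
    using Hausdorff_weak_ell2 by (intro continuous_imp_embedding_map)
  then show ?thesis
    unfolding uniform_Eberlein_compact_def using real_hilbert_space_ell2 \<open>compact_space _\<close> by blast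
qed

end

subsection \<open>Supercompactness\<close>

lemma generate_topology_on_base:
  assumes "generate_topology_on \<B> V" "y \<in> V"
  shows "\<exists>\<F>\<subseteq>\<B>. finite \<F> \<and> y \<in> \<Inter>\<F> \<and> \<Union>\<B> \<inter> \<Inter>\<F> \<subseteq> V"
  using assms
proof (induction arbitrary: y)
  case (Int a b)
  obtain \<F> where "\<F> \<subseteq> \<B>" "finite \<F>" "y \<in> \<Inter>\<F>" "\<Union>\<B> \<inter> \<Inter>\<F> \<subseteq> a"
    using Int by (metis IntD1)
  moreover obtain \<G> where "\<G> \<subseteq> \<B>" "finite \<G>" "y \<in> \<Inter>\<G>" "\<Union>\<B> \<inter> \<Inter>\<G> \<subseteq> b"
    using Int by (metis IntD2)
  ultimately show ?case
    by (intro exI[of _ "\<F> \<union> \<G>"]) auto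
next
  case (UN K)
  then obtain k where k: "k \<in> K" "y \<in> k"
    by blast
  then obtain \<F> where "\<F> \<subseteq> \<B>" "finite \<F>" "y \<in> \<Inter>\<F>" "\<Union>\<B> \<inter> \<Inter>\<F> \<subseteq> k"
    using UN.IH by meson
  then show ?case
    using k by (intro exI[of _ \<F>]) auto
next
  case (Basis s)
  then show ?case
    by (intro exI[of _ "{s}"]) auto
qed simp

text \<open>The family consists of the intersections of members of the closed subbase.\<close>
lemma supercompact_triple_family:
  assumes sc: "supercompact_space X" and comp: "compact_space X"
  shows "\<exists>\<I>. (\<forall>Q\<in>\<I>. closedin X Q) \<and>
    (\<forall>A\<in>\<I>. \<forall>B\<in>\<I>. \<forall>C\<in>\<I>. A \<inter> B \<noteq> {} \<and> A \<inter> C \<noteq> {} \<and> B \<inter> C \<noteq> {} \<longrightarrow> A \<inter> B \<inter> C \<noteq> {}) \<and>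
    (\<forall>F U. closedin X F \<and> openin X U \<and> F \<subseteq> U \<longrightarrow> (\<exists>\<Q>\<subseteq>\<I>. finite \<Q> \<and> F \<subseteq> \<Union>\<Q> \<and> \<Union>\<Q> \<subseteq> U))"
proof -
  obtain \<B> where gen: "topology_generated_by \<B> = X" and
    two: "\<And>\<C>. \<C> \<subseteq> \<B> \<Longrightarrow> \<Union>\<C> = topspace X \<Longrightarrow> \<exists>\<D>\<subseteq>\<C>. finite \<D> \<and> card \<D> \<le> 2 \<and> \<Union>\<D> = topspace X"
    using sc unfolding supercompact_space_def by metis
  define T where "T = topspace X"
  have T: "T = \<Union>\<B>"
    unfolding T_def using topology_generated_by_topspace[of \<B>] gen by simp
  have op: "openin X B" if "B \<in> \<B>" for B
    using topology_generated_by_Basis[OF that] gen by simp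
  define \<I> where "\<I> = (\<lambda>\<C>. T - \<Union>\<C>) ` Pow \<B>"
  have closed: "\<forall>Q\<in>\<I>. closedin X Q"
    unfolding \<I>_def T_def using op by (auto intro!: openin_Union closedin_diff)
  have triple: "A \<inter> B \<inter> C \<noteq> {}"
    if I: "A \<in> \<I>" "B \<in> \<I>" "C \<in> \<I>" and ne: "A \<inter> B \<noteq> {}" "A \<inter> C \<noteq> {}" "B \<inter> C \<noteq> {}" for A B C
  proof
    assume empty: "A \<inter> B \<inter> C = {}"
    obtain \<A> where \<A>: "\<A> \<subseteq> \<B>" "A = T - \<Union>\<A>"
      using I(1) unfolding \<I>_def by auto
    obtain \<B>' where \<B>': "\<B>' \<subseteq> \<B>" "B = T - \<Union>\<B>'"
      using I(2) unfolding \<I>_def by auto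
    obtain \<C> where \<C>: "\<C> \<subseteq> \<B>" "C = T - \<Union>\<C>"
      using I(3) unfolding \<I>_def by auto
    \<comment> \<open>In terms of complements, the three families cover together but no two of them
      do. So a subcover has a member outside each union of two families, and these three members are
      distinct, against the bound of two.\<close>
    have "\<Union>(\<A> \<union> \<B>' \<union> \<C>) = topspace X"
      using empty \<A> \<B>' \<C> T unfolding T_def by blast
    then obtain \<D> where \<D>: "\<D> \<subseteq> \<A> \<union> \<B>' \<union> \<C>" "finite \<D>" "card \<D> \<le> 2" "\<Union>\<D> = T"
      using two[of "\<A> \<union> \<B>' \<union> \<C>"] \<A>(1) \<B>'(1) \<C>(1) unfolding T_def by auto
    have pair: "\<exists>D\<in>\<D>. D \<notin> \<E>" if "T - \<Union>\<E> \<noteq> {}" for \<E>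
      using that \<D>(4) by blast
    have "T - \<Union>(\<A> \<union> \<B>') \<noteq> {}" "T - \<Union>(\<A> \<union> \<C>) \<noteq> {}" "T - \<Union>(\<B>' \<union> \<C>) \<noteq> {}"
      using ne \<A>(2) \<B>'(2) \<C>(2) by blast+
    then obtain D1 D2 D3 where D: "D1 \<in> \<D>" "D2 \<in> \<D>" "D3 \<in> \<D>"
      "D1 \<notin> \<A> \<union> \<B>'" "D2 \<notin> \<A> \<union> \<C>" "D3 \<notin> \<B>' \<union> \<C>"
      using pair by meson
    then have "D1 \<noteq> D2" "D1 \<noteq> D3" "D2 \<noteq> D3"
      using \<D>(1) by blast+
    then have "card {D1, D2, D3} = 3"
      by simp
    then show False
      using card_mono[OF \<D>(2), of "{D1, D2, D3}"] D(1-3) \<D>(3) by simp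
  qed
  have cover: "\<exists>\<Q>\<subseteq>\<I>. finite \<Q> \<and> F \<subseteq> \<Union>\<Q> \<and> \<Union>\<Q> \<subseteq> U"
    if F: "closedin X F" "openin X U" "F \<subseteq> U" for F U
  proof -
    \<comment> \<open>\<open>sep W\<close> says that \<open>F\<close> has a finite cover by members
      of the family that avoids \<open>W\<close>. It holds for a neighbourhood of each point of
      \<open>T - U\<close> and passes to finite unions by pairwise intersection of the covers, so
      compactness of \<open>T - U\<close> gives the result.\<close>
    define sep where "sep W \<longleftrightarrow> (\<exists>\<Q>\<subseteq>\<I>. finite \<Q> \<and> F \<subseteq> \<Union>\<Q> \<and> \<Union>\<Q> \<inter> W = {})" for W
    have FT: "F \<subseteq> T"
      using F(1) closedin_subset unfolding T_def by blast
    have sub: "\<Union>\<Q> \<subseteq> T" if "\<Q> \<subseteq> \<I>" for \<Q>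
      using that unfolding \<I>_def by auto
    have "\<exists>W. openin X W \<and> y \<in> W \<and> sep W" if y: "y \<in> T - U" for y
    proof -
      have "openin X (T - F)"
        using F(1) unfolding T_def by blast
      then have "generate_topology_on \<B> (T - F)"
        using gen openin_topology_generated_by by metis
      moreover have "y \<in> T - F"
        using y F(3) by blast
      ultimately have "\<exists>\<F>\<subseteq>\<B>. finite \<F> \<and> y \<in> \<Inter>\<F> \<and> \<Union>\<B> \<inter> \<Inter>\<F> \<subseteq> T - F"
        by (rule generate_topology_on_base)
      then obtain \<F> where \<F>: "\<F> \<subseteq> \<B>" "finite \<F>" "y \<in> \<Inter>\<F>" "T \<inter> \<Inter>\<F> \<subseteq> T - F"
        unfolding T by (elim exE conjE)
      have "openin X (T \<inter> \<Inter>\<F>)"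
      proof (cases "\<F> = {}")
        case True
        then show ?thesis
          unfolding T_def by simp
      next
        case False
        then show ?thesis
          using \<F>(1,2) op unfolding T_def by (intro openin_Int openin_Inter) auto
      qed
      moreover have "sep (T \<inter> \<Inter>\<F>)"
        unfolding sep_def
      proof (intro exI[of _ "(\<lambda>B. T - \<Union>{B}) ` \<F>"] conjI)
        show "(\<lambda>B. T - \<Union>{B}) ` \<F> \<subseteq> \<I>"
          unfolding \<I>_def using \<F>(1) by blast
        show "F \<subseteq> \<Union>((\<lambda>B. T - \<Union>{B}) ` \<F>)"
          using FT \<F>(4) by auto
      qed (use \<F>(2) in auto)
      ultimately show ?thesis
        using y \<F>(3) by (intro exI[of _ "T \<inter> \<Inter>\<F>"]) auto
    qed
    then have cov: "T - U \<subseteq> \<Union>{W. openin X W \<and> sep W}"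
      by blast
    have "compactin X (T - U)"
      using closedin_compact_space[OF comp] F(2) unfolding T_def by blast
    then have "\<exists>\<W>. finite \<W> \<and> \<W> \<subseteq> {W. openin X W \<and> sep W} \<and> T - U \<subseteq> \<Union>\<W>"
      by (rule compactinD) (use cov in auto)
    then obtain \<W> where \<W>: "finite \<W>" "\<W> \<subseteq> {W. openin X W \<and> sep W}" "T - U \<subseteq> \<Union>\<W>"
      by (elim exE conjE)
    have "sep (\<Union>\<W>)"
      using \<W>(1,2)
    proof (induction \<W> rule: finite_induct)
      case empty
      have "T - \<Union>{} \<in> \<I>"
        unfolding \<I>_def by (rule image_eqI[of _ _ "{}"]) auto
      then show ?case
        unfolding sep_def using FT by (intro exI[of _ "{T}"]) auto
    next
      case (insert W \<W>)
      then have "sep W" "sep (\<Union>\<W>)"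
        by auto
      then obtain \<Q> \<R> where Q: "\<Q> \<subseteq> \<I>" "finite \<Q>" "F \<subseteq> \<Union>\<Q>" "\<Union>\<Q> \<inter> W = {}"
        and R: "\<R> \<subseteq> \<I>" "finite \<R>" "F \<subseteq> \<Union>\<R>" "\<Union>\<R> \<inter> \<Union>\<W> = {}"
        unfolding sep_def by (elim exE conjE)
      have int: "A \<inter> B \<in> \<I>" if "A \<in> \<I>" "B \<in> \<I>" for A B
      proof -
        obtain \<A> \<B>' where "\<A> \<subseteq> \<B>" "A = T - \<Union>\<A>" "\<B>' \<subseteq> \<B>" "B = T - \<Union>\<B>'"
          using \<open>A \<in> \<I>\<close> \<open>B \<in> \<I>\<close> unfolding \<I>_def by auto
        then show ?thesis
          unfolding \<I>_def by (intro image_eqI[of _ _ "\<A> \<union> \<B>'"]) auto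
      qed
      show ?case
        unfolding sep_def
      proof (intro exI[of _ "(\<lambda>(A, B). A \<inter> B) ` (\<Q> \<times> \<R>)"] conjI)
        show "(\<lambda>(A, B). A \<inter> B) ` (\<Q> \<times> \<R>) \<subseteq> \<I>"
          using int Q(1) R(1) by auto
        show "F \<subseteq> \<Union>((\<lambda>(A, B). A \<inter> B) ` (\<Q> \<times> \<R>))"
          using Q(3) R(3) by fastforce
        show "\<Union>((\<lambda>(A, B). A \<inter> B) ` (\<Q> \<times> \<R>)) \<inter> \<Union>(insert W \<W>) = {}"
          using Q(4) R(4) by auto
      qed (use Q(2) R(2) in auto)
    qed
    then obtain \<Q> where "\<Q> \<subseteq> \<I>" "finite \<Q>" "F \<subseteq> \<Union>\<Q>" "\<Union>\<Q> \<inter> \<Union>\<W> = {}"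
      unfolding sep_def by (elim exE conjE)
    moreover from this have "\<Union>\<Q> \<subseteq> U"
      using sub[of \<Q>] \<W>(3) by blast
    ultimately show ?thesis
      by (intro exI[of _ \<Q>]) auto
  qed
  show ?thesis
    by (intro exI[of _ \<I>] conjI) (use closed triple cover in auto)
qed

section \<open>Parts of closed sets over infinity, and the contradiction\<close>

context fibred
begin

text \<open>This is the projection denoted \<open>Q\<^sub>\<infinity>\<close>.\<close>

definition base_part :: "(real \<Rightarrow> real) set \<Rightarrow> real set" where
  "base_part Q = (\<lambda>u. u 0) ` {u \<in> Q. \<forall>x\<in>L. u x = 0}"

lemma base_part_iff:
  assumes "Q \<subseteq> fibspace L"
  shows "y \<in> base_part Q \<longleftrightarrow> base_pt y \<in> Q"
proof
  assume "y \<in> base_part Q"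
  then obtain u where u: "u \<in> Q" "\<forall>x\<in>L. u x = 0" "y = u 0"
    unfolding base_part_def by blast
  then have "u = base_pt y"
    using fibspace_base_pt[of u] assms by blast
  then show "base_pt y \<in> Q"
    using u(1) by simp
next
  assume "base_pt y \<in> Q"
  then show "y \<in> base_part Q"
    unfolding base_part_def using L_nonzero by (intro image_eqI[of _ _ "base_pt y"]) auto
qed

lemma closedin_fibspace_coord: "x \<in> L \<Longrightarrow> closedin (top_of_set (fibspace L)) {v \<in> fibspace L. v x = c}"
proof -
  assume x: "x \<in> L"
  have "closedin (top_of_set (fibspace L)) (fibspace L \<inter> (\<lambda>v. v x) -` {c})"
    by (rule continuous_closedin_preimage)
       (auto intro: continuous_on_subset[OF continuous_on_product_coordinates])
  moreover have "fibspace L \<inter> (\<lambda>v. v x) -` {c} = {v \<in> fibspace L. v x = c}"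
    by auto
  ultimately show ?thesis
    by simp
qed

lemma compact_closedin_fibspace: "closedin (top_of_set (fibspace L)) Q \<Longrightarrow> compact Q"
  using closedin_compact compact_fibspace by blast

lemma compact_base_part:
  assumes "closedin (top_of_set (fibspace L)) Q"
  shows "compact (base_part Q)"
proof -
  have "closedin (top_of_set (fibspace L)) (Q - (\<Union>x\<in>L. {v \<in> fibspace L. v x = 1}))"
    using assms by (intro closedin_diff openin_Union) (auto intro: openin_fibspace_coord)
  moreover have "{u \<in> Q. \<forall>x\<in>L. u x = 0} = Q - (\<Union>x\<in>L. {v \<in> fibspace L. v x = 1})"
    using closedin_subset[OF assms] fibspace_val by fastforce
  ultimately have "compact {u \<in> Q. \<forall>x\<in>L. u x = 0}"
    using compact_closedin_fibspace by simp
  then show ?thesis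
    unfolding base_part_def
    by (rule compact_continuous_image[rotated]) (auto intro: continuous_on_subset[OF continuous_on_product_coordinates])
qed

text \<open>Over a closed interval missing \<open>base_part Q\<close> the set \<open>Q\<close> is
  compact and covered by disjoint open fibres, so it meets finitely many of them. Countably many
  such intervals, with rational ends, cover the complement of \<open>base_part Q\<close>.\<close>

lemma countable_off_base_part:
  assumes Q: "closedin (top_of_set (fibspace L)) Q"
  shows "countable {x \<in> L. \<exists>y. fib_pt x y \<in> Q \<and> y \<notin> base_part Q}"
proof -
  have sub: "Q \<subseteq> fibspace L"
    using closedin_subset[OF Q] by simp
  have fin: "finite {x \<in> L. \<exists>y\<in>{a..b}. fib_pt x y \<in> Q}" if ab: "{a..b} \<inter> base_part Q = {}" for a b
  proof -
    let ?K = "Q \<inter> {v \<in> fibspace L. v 0 \<in> {a..b}}"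
    have "compactin (top_of_set (fibspace L)) ?K"
      using compact_fibspace by (intro closedin_compact_space closedin_Int Q closedin_fibspace_0) (auto simp: compact_space_subtopology)
    moreover have "?K \<subseteq> \<Union>((\<lambda>x. {v \<in> fibspace L. v x = 1}) ` L)"
    proof
      fix v assume v: "v \<in> ?K"
      then have "v 0 \<notin> base_part Q"
        using ab by auto
      then obtain x where "x \<in> L" "v x \<noteq> 0"
        using v unfolding base_part_def by blast
      then show "v \<in> \<Union>((\<lambda>x. {v \<in> fibspace L. v x = 1}) ` L)"
        using v fibspace_val by blast
    qed
    ultimately have "\<exists>\<F>. finite \<F> \<and> \<F> \<subseteq> (\<lambda>x. {v \<in> fibspace L. v x = 1}) ` L \<and> ?K \<subseteq> \<Union>\<F>"
      by (intro compactinD) (auto intro: openin_fibspace_coord)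
    then obtain \<F> where \<F>: "finite \<F>" "\<F> \<subseteq> (\<lambda>x. {v \<in> fibspace L. v x = 1}) ` L" "?K \<subseteq> \<Union>\<F>"
      by (elim exE conjE)
    obtain M where M: "M \<subseteq> L" "finite M" "\<F> = (\<lambda>x. {v \<in> fibspace L. v x = 1}) ` M"
      using finite_subset_image[OF \<F>(1,2)] by blast
    have "{x \<in> L. \<exists>y\<in>{a..b}. fib_pt x y \<in> Q} \<subseteq> M"
    proof
      fix x assume "x \<in> {x \<in> L. \<exists>y\<in>{a..b}. fib_pt x y \<in> Q}"
      then obtain y where y: "x \<in> L" "y \<in> {a..b}" "fib_pt x y \<in> Q"
        by blast
      then have "fib_pt x y \<in> ?K"
        using L_nonzero sub by auto
      then obtain z where z: "z \<in> M" "fib_pt x y z = 1"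
        using \<F>(3) M(3) by auto
      then have "z = x"
        using L_nonzero[of z] M(1) fib_pt_simps(3)[of z x y] by auto
      then show "x \<in> M"
        using z(1) by simp
    qed
    then show ?thesis
      using M(2) finite_subset by blast
  qed
  let ?C = "{(a, b). a \<in> \<rat> \<and> b \<in> \<rat> \<and> {a..b} \<inter> base_part Q = {}}"
  have "countable ?C"
    by (rule countable_subset[of _ "\<rat> \<times> \<rat>"]) (auto simp: countable_rat)
  then have "countable (\<Union>(a, b)\<in>?C. {x \<in> L. \<exists>y\<in>{a..b}. fib_pt x y \<in> Q})"
    using fin by (intro countable_UN) (auto intro: countable_finite)
  moreover have "{x \<in> L. \<exists>y. fib_pt x y \<in> Q \<and> y \<notin> base_part Q} \<subseteq>
      (\<Union>(a, b)\<in>?C. {x \<in> L. \<exists>y\<in>{a..b}. fib_pt x y \<in> Q})"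
  proof
    fix x assume "x \<in> {x \<in> L. \<exists>y. fib_pt x y \<in> Q \<and> y \<notin> base_part Q}"
    then obtain y where y: "x \<in> L" "fib_pt x y \<in> Q" "y \<notin> base_part Q"
      by blast
    have op: "open (- base_part Q)"
      using compact_base_part[OF Q] by (simp add: compact_imp_closed open_Compl)
    obtain e where e: "e > 0" "ball y e \<subseteq> - base_part Q"
      using iffD1[OF open_contains_ball_eq[OF op], of y] y(3) by auto
    obtain a where a: "a \<in> \<rat>" "y - e < a" "a < y"
      using Rats_dense_in_real[of "y - e" y] e(1) by auto
    obtain b where b: "b \<in> \<rat>" "y < b" "b < y + e"
      using Rats_dense_in_real[of y "y + e"] e(1) by auto
    have "{a..b} \<subseteq> ball y e"
      using a b by (auto simp: dist_real_def)
    then have "(a, b) \<in> ?C"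
      using e(2) a(1) b(1) by blast
    moreover have "y \<in> {a..b}"
      using a b by simp
    ultimately show "x \<in> (\<Union>(a, b)\<in>?C. {x \<in> L. \<exists>y\<in>{a..b}. fib_pt x y \<in> Q})"
      using y(1,2) by blast
  qed
  ultimately show ?thesis
    by (rule countable_subset[rotated])
qed

lemma not_supercompact_fibspace:
  assumes "uncountable L" and Luzin: "\<And>M. meager M \<Longrightarrow> countable (L \<inter> M)"
  shows "\<not> supercompact_space (top_of_set (fibspace L))"
proof
  assume sc: "supercompact_space (top_of_set (fibspace L))"
  have comp: "compact_space (top_of_set (fibspace L))"
    by (simp add: compact_space_subtopology compact_fibspace)
  obtain \<I> where I: "\<forall>Q\<in>\<I>. closedin (top_of_set (fibspace L)) Q"
    "\<forall>A\<in>\<I>. \<forall>B\<in>\<I>. \<forall>C\<in>\<I>. A \<inter> B \<noteq> {} \<and> A \<inter> C \<noteq> {} \<and> B \<inter> C \<noteq> {} \<longrightarrow> A \<inter> B \<inter> C \<noteq> {}"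
    "\<forall>F U. closedin (top_of_set (fibspace L)) F \<and> openin (top_of_set (fibspace L)) U \<and> F \<subseteq> U \<longrightarrow>
      (\<exists>\<Q>\<subseteq>\<I>. finite \<Q> \<and> F \<subseteq> \<Union>\<Q> \<and> \<Union>\<Q> \<subseteq> U)"
    using supercompact_triple_family[OF sc comp] by (elim exE conjE)
  note closed = I(1)[rule_format] and triple = I(2)[rule_format, OF _ _ _ conjI[OF _ conjI]]
    and cover = I(3)[rule_format, OF conjI[OF _ conjI]]
  have sub: "Q \<subseteq> fibspace L" if "Q \<in> \<I>" for Q
    using closedin_subset[OF closed[OF that]] by simp
  define mesh where "mesh n \<Q> \<longleftrightarrow> \<Q> \<subseteq> \<I> \<and> finite \<Q> \<and> fibspace L \<subseteq> \<Union>\<Q> \<and>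
    (\<forall>Q\<in>\<Q>. \<forall>u\<in>Q. \<forall>v\<in>Q. \<bar>u 0 - v 0\<bar> < 1 / 2 ^ n)" for n :: nat and \<Q>
  have "\<exists>\<Q>. mesh n \<Q>" for n
  proof -
    \<comment> \<open>A strip of width \<open>d\<close> thickened by \<open>d / 2\<close> on both
      sides has width \<open>2 * d\<close>, half of the allowed mesh.\<close>
    define d where "d = (1 :: real) / 2 ^ Suc (Suc n)"
    have d: "d > 0"
      unfolding d_def by simp
    define strip where "strip j \<Q> \<longleftrightarrow> \<Q> \<subseteq> \<I> \<and> finite \<Q> \<and> {v \<in> fibspace L. v 0 \<in> {real j * d..real j * d + d}} \<subseteq> \<Union>\<Q> \<and>
        \<Union>\<Q> \<subseteq> {v \<in> fibspace L. v 0 \<in> {real j * d - d / 2<..<real j * d + d + d / 2}}" for j :: nat and \<Q>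
    have "\<exists>\<Q>. strip j \<Q>" for j
      unfolding strip_def using d by (intro cover closedin_fibspace_0 openin_fibspace_0) auto
    then obtain \<Q> where "\<And>j. strip j (\<Q> j)"
      by metis
    then have \<Q>: "\<And>j. \<Q> j \<subseteq> \<I>" "\<And>j. finite (\<Q> j)"
        "\<And>j. {v \<in> fibspace L. v 0 \<in> {real j * d..real j * d + d}} \<subseteq> \<Union>(\<Q> j)"
        "\<And>j. \<Union>(\<Q> j) \<subseteq> {v \<in> fibspace L. v 0 \<in> {real j * d - d / 2<..<real j * d + d + d / 2}}"
      unfolding strip_def by (simp_all only: simp_thms)
    let ?Q = "\<Union>j\<in>{..nat \<lfloor>2 / d\<rfloor>}. \<Q> j"
    have "fibspace L \<subseteq> \<Union>?Q"
    proof
      fix v assume v: "v \<in> fibspace L"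
      define j where "j = nat \<lfloor>v 0 / d\<rfloor>"
      have v0: "0 \<le> v 0" "v 0 \<le> 2"
        using fibspace_0[OF v] by auto
      then have "real j = of_int \<lfloor>v 0 / d\<rfloor>"
        unfolding j_def using d by simp
      then have "real j \<le> v 0 / d" "v 0 / d < real j + 1"
        by linarith+
      then have "v 0 \<in> {real j * d..real j * d + d}"
        using d by (simp add: field_simps)
      moreover have "j \<le> nat \<lfloor>2 / d\<rfloor>"
        unfolding j_def using v0 d by (intro nat_mono floor_mono divide_right_mono) auto
      ultimately show "v \<in> \<Union>?Q"
        using \<Q>(3)[of j] v by blast
    qed
    moreover have "\<bar>u 0 - v 0\<bar> < 1 / 2 ^ n" if Q: "Q \<in> ?Q" "u \<in> Q" "v \<in> Q" for Q u v
    proof -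
      obtain j where "Q \<in> \<Q> j"
        using Q(1) by blast
      then have "u 0 \<in> {real j * d - d / 2<..<real j * d + d + d / 2}" "v 0 \<in> {real j * d - d / 2<..<real j * d + d + d / 2}"
        using \<Q>(4)[of j] Q(2,3) by blast+
      then have "\<bar>u 0 - v 0\<bar> < 2 * d"
        by auto
      moreover have "2 * d \<le> 1 / 2 ^ n"
        unfolding d_def by (simp add: field_simps)
      ultimately show ?thesis
        by linarith
    qed
    moreover have "?Q \<subseteq> \<I>"
      using \<Q>(1) by blast
    moreover have "finite ?Q"
      using \<Q>(2) by simp
    ultimately show ?thesis
      unfolding mesh_def by (intro exI[of _ ?Q] conjI ballI)
  qed
  then obtain \<Q> where "\<And>n. mesh n (\<Q> n)"
    by metis
  then have \<Q>: "\<And>n. \<Q> n \<subseteq> \<I>" "\<And>n. finite (\<Q> n)" "\<And>n. fibspace L \<subseteq> \<Union>(\<Q> n)"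
      "\<And>n Q u v. Q \<in> \<Q> n \<Longrightarrow> u \<in> Q \<Longrightarrow> v \<in> Q \<Longrightarrow> \<bar>u 0 - v 0\<bar> < 1 / 2 ^ n"
    unfolding mesh_def by blast+
  define P where "P n = (\<lambda>Q. Sup (base_part Q)) ` \<Q> n" for n
  \<comment> \<open>The finitely many compact sets \<open>base_part R\<close> that miss
    \<open>q\<close> also miss an interval around it.\<close>
  define gap where "gap q m d \<longleftrightarrow> d > 0 \<and> (\<forall>R\<in>\<Q> m. base_part R \<inter> {q<..<q + d} \<noteq> {} \<longrightarrow> q \<in> base_part R)"
    for q m and d :: real
  have "\<exists>d. gap q m d" for q m
  proof -
    let ?C = "\<Union>R\<in>{R \<in> \<Q> m. q \<notin> base_part R}. base_part R"
    have "closed ?C"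
      using \<Q>(1,2)[of m] closed by (intro closed_UN) (auto intro!: compact_imp_closed compact_base_part)
    then have op: "open (- ?C)"
      by (rule open_Compl)
    have "q \<in> - ?C"
      by auto
    then obtain d where d: "d > 0" "ball q d \<subseteq> - ?C"
      using iffD1[OF open_contains_ball_eq[OF op], of q] by auto
    have "{q<..<q + d} \<subseteq> ball q d"
      by (auto simp: dist_real_def)
    then show ?thesis
      unfolding gap_def using d by (intro exI[of _ d]) blast
  qed
  then obtain \<delta> where "\<And>q m. gap q m (\<delta> q m)"
    by metis
  then have \<delta>: "\<And>q m. \<delta> q m > (0 :: real)"
      "\<And>q m R. R \<in> \<Q> m \<Longrightarrow> base_part R \<inter> {q<..<q + \<delta> q m} \<noteq> {} \<Longrightarrow> q \<in> base_part R"
    unfolding gap_def by blast+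
  \<comment> \<open>Avoiding the three countable sets gives, in this order, that all parts over
    \<open>x\<close> project into the parts over infinity, that \<open>x\<close> is not one of the
    maxima in \<open>P n\<close>, and that \<open>x\<close> is tuned.\<close>
  define bad where "bad = (\<Union>n. \<Union>Q\<in>\<Q> n. {x \<in> L. \<exists>y. fib_pt x y \<in> Q \<and> y \<notin> base_part Q}) \<union>
    (\<Union>n. P n) \<union> L \<inter> {x \<in> {0<..<1}. \<exists>k. \<not> tuned P \<delta> k x}"
  have finP: "finite (P n)" for n
    unfolding P_def using \<Q>(2) by simp
  have "countable bad"
  proof -
    have "countable (\<Union>n. \<Union>Q\<in>\<Q> n. {x \<in> L. \<exists>y. fib_pt x y \<in> Q \<and> y \<notin> base_part Q})"
      using \<Q>(1,2) closed by (intro countable_UN countable_off_base_part) (auto intro: countable_finite)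
    moreover have "countable (\<Union>n. P n)"
      using finP by (auto intro: countable_finite)
    moreover have "countable (L \<inter> {x \<in> {0<..<1}. \<exists>k. \<not> tuned P \<delta> k x})"
      by (intro Luzin meager_not_tuned finP \<delta>(1))
    ultimately show ?thesis
      unfolding bad_def by simp
  qed
  then have "\<not> L \<subseteq> bad"
    using assms(1) countable_subset by blast
  then obtain x where x: "x \<in> L" "x \<notin> bad"
    by blast
  have flat: "y \<in> base_part Q" if "Q \<in> \<Q> n" "fib_pt x y \<in> Q" for y Q n
    using x that unfolding bad_def by blast
  have xP: "x \<notin> P n" for n
    using x(2) unfolding bad_def by simp
  have x01: "x \<in> {0<..<1}"
    using x(1) L_unit by blast
  have tun: "tuned P \<delta> k x" for k
    using x x01 unfolding bad_def by simp
  have x0: "x \<noteq> 0"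
    using x(1) L_nonzero by blast
  let ?F = "{v \<in> fibspace L. v x = 1}"
  \<comment> \<open>The fibre over \<open>x\<close> is both open and closed, so it is a finite union
    of members of the family.\<close>
  obtain \<A> where \<A>: "\<A> \<subseteq> \<I>" "finite \<A>" "?F \<subseteq> \<Union>\<A>" "\<Union>\<A> \<subseteq> ?F"
    using cover[OF closedin_fibspace_coord[OF x(1), of 1] openin_fibspace_coord[OF x(1), of 1]] by auto
  have "closedin (top_of_set (fibspace L)) (\<Union>{A \<in> \<A>. fib_pt x x \<notin> A})"
    using \<A>(1,2) closed by (intro closedin_Union) auto
  then have op: "openin (top_of_set (fibspace L)) (fibspace L - \<Union>{A \<in> \<A>. fib_pt x x \<notin> A})"
    by (intro openin_diff) (simp_all add: openin_subtopology_refl)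
  have "fib_pt x x \<in> fibspace L - \<Union>{A \<in> \<A>. fib_pt x x \<notin> A}"
    using fib_pt_in_fibspace[OF x(1) fib_self] by blast
  from fibspace_nhd[OF op this] obtain \<epsilon> W where \<epsilon>: "\<epsilon> > 0" "W \<subseteq> L"
    "\<forall>v\<in>fibspace L. \<bar>v 0 - fib_pt x x 0\<bar> < \<epsilon> \<longrightarrow> (\<forall>t\<in>W. v t = fib_pt x x t) \<longrightarrow> v \<in> fibspace L - \<Union>{A \<in> \<A>. fib_pt x x \<notin> A}"
    by (elim exE conjE)
  \<comment> \<open>The finitely many members missing the centre have a closed union, so a point of
    the fibre close to the centre lies only in members that contain the centre.\<close>
  have center: "fib_pt x x \<in> A" if A: "A \<in> \<A>" "fib_pt x y \<in> A" "\<bar>y - x\<bar> < \<epsilon>" "y \<in> fib x" for A y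
  proof -
    have eq: "fib_pt x y t = fib_pt x x t" if "t \<in> W" for t
      using that \<epsilon>(2) L_nonzero[of t] by (cases "t = x") auto
    have "fib_pt x y \<in> fibspace L - \<Union>{A \<in> \<A>. fib_pt x x \<notin> A}"
      using \<epsilon>(3)[rule_format, OF fib_pt_in_fibspace[OF x(1) A(4)]] A(3) eq x0 by simp
    then show ?thesis
      using A(1,2) by blast
  qed
  obtain k0 :: nat where k0: "(1/2) ^ k0 < \<epsilon>"
    using real_arch_pow_inv[OF \<epsilon>(1), of "1/2"] by auto
  \<comment> \<open>The point \<open>e\<close> will be reached from \<open>x\<close> through
    \<open>q\<close> in two steps shorter than \<open>1 / 2 ^ k\<close>, which add up to less than
    \<open>\<epsilon>\<close>.\<close>
  define k where "k = Suc k0"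
  have k: "1 / 2 ^ k + 1 / 2 ^ k < \<epsilon>"
    using k0 unfolding k_def by (simp add: power_one_over)
  obtain n where n: "n \<ge> k" "\<And>q. q \<in> P n \<Longrightarrow> x < q \<Longrightarrow> q < x + 1 / 2 ^ n \<Longrightarrow>
      \<exists>m\<ge>k. fib x \<inter> {q - 1 / 2 ^ m..q} = {} \<and> fib x \<inter> {q <..< q + \<delta> q m} \<noteq> {}"
    using tun[of k] unfolding tuned_def by auto
  have pw: "1 / 2 ^ j \<le> (1 :: real) / 2 ^ k" if "j \<ge> k" for j
    using that by (intro divide_left_mono power_increasing) auto
  obtain Q where Q: "Q \<in> \<Q> n" "fib_pt x x \<in> Q"
    using \<Q>(3)[of n] fib_pt_in_fibspace[OF x(1) fib_self] by blast
  have QI: "Q \<in> \<I>"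
    using Q(1) \<Q>(1) by blast
  have xQ: "x \<in> base_part Q"
    using flat[OF Q] .
  define q where "q = Sup (base_part Q)"
  have cQ: "compact (base_part Q)"
    using compact_base_part closed QI by blast
  have qQ: "q \<in> base_part Q"
    unfolding q_def using cQ xQ by (intro closed_contains_Sup bounded_imp_bdd_above compact_imp_bounded compact_imp_closed) auto
  have max: "y \<le> q" if "y \<in> base_part Q" for y
    unfolding q_def using that cQ by (intro cSup_upper bounded_imp_bdd_above compact_imp_bounded)
  have qP: "q \<in> P n"
    unfolding P_def q_def using Q(1) by blast
  have base_q: "base_pt q \<in> Q"
    using qQ base_part_iff[OF sub[OF QI]] by simp
  \<comment> \<open>Equality is excluded because \<open>x\<close> is not in
    \<open>P n\<close>.\<close>
  have "x < q"
    using max[OF xQ] xP[of n] qP by (metis order_less_le)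
  moreover have "q < x + 1 / 2 ^ n"
    using \<Q>(4)[OF Q(1) base_q Q(2)] x0 by simp
  ultimately obtain m where m: "m \<ge> k" "fib x \<inter> {q - 1 / 2 ^ m..q} = {}" "fib x \<inter> {q <..< q + \<delta> q m} \<noteq> {}"
    using n(2)[OF qP] by blast
  then obtain e where e: "e \<in> fib x" "q < e" "e < q + \<delta> q m"
    by auto
  have eS: "fib_pt x e \<in> fibspace L"
    using fib_pt_in_fibspace x(1) e(1) by blast
  then obtain R where R: "R \<in> \<Q> m" "fib_pt x e \<in> R"
    using \<Q>(3)[of m] by blast
  have RI: "R \<in> \<I>"
    using R(1) \<Q>(1) by blast
  have "e \<in> base_part R \<inter> {q<..<q + \<delta> q m}"
    using flat[OF R] e(2,3) by simp
  then have "q \<in> base_part R"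
    using \<delta>(2)[OF R(1), of q] by blast
  then have base_q': "base_pt q \<in> R"
    using base_part_iff[OF sub[OF RI]] by simp
  have "\<bar>e - q\<bar> < 1 / 2 ^ m"
    using \<Q>(4)[OF R(1,2) base_q'] x0 by simp
  then have "\<bar>e - x\<bar> < \<epsilon>"
    using \<open>x < q\<close> \<open>q < x + 1 / 2 ^ n\<close> e(2) pw[OF m(1)] pw[OF n(1)] k by linarith
  moreover obtain A where A: "A \<in> \<A>" "fib_pt x e \<in> A"
    using \<A>(3) eS by auto
  ultimately have "fib_pt x x \<in> A"
    using center e(1) by blast
  \<comment> \<open>The pairwise common points are \<open>base_pt q\<close> for \<open>Q\<close> and
    \<open>R\<close>, \<open>fib_pt x x\<close> for \<open>Q\<close> and \<open>A\<close>, and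
    \<open>fib_pt x e\<close> for \<open>R\<close> and \<open>A\<close>.\<close>
  then have "Q \<inter> R \<inter> A \<noteq> {}"
    using triple[OF QI RI, of A] A \<A>(1) base_q base_q' Q(2) R(2) by blast
  then obtain v where v: "v \<in> Q" "v \<in> R" "v \<in> A"
    by blast
  then have vS: "v \<in> fibspace L" "v x = 1"
    using A(1) \<A>(4) by blast+
  then have f: "v 0 \<in> fib x" "v = fib_pt x (v 0)"
    using fibspace_fib[OF vS(1) x(1)] fibspace_fib_pt[OF vS(1) x(1)] by auto
  \<comment> \<open>Membership in \<open>Q\<close> bounds \<open>v 0\<close> by the maximum
    \<open>q\<close>, and membership in \<open>R\<close> puts it within \<open>1 / 2 ^ m\<close> of
    \<open>q\<close>, a range in which \<open>fib x\<close> has no points.\<close>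
  then have "v 0 \<le> q"
    using max flat[OF Q(1)] v(1) by metis
  moreover have "\<bar>v 0 - q\<bar> < 1 / 2 ^ m"
    using \<Q>(4)[OF R(1) v(2) base_q'] by simp
  ultimately have "v 0 \<in> fib x \<inter> {q - 1 / 2 ^ m..q}"
    using f(1) by auto
  then show False
    using m(2) by blast
qed

end

theorem corollary5p3:
  assumes "cof_meager_eq omega1"
  shows "\<exists>X :: (real \<Rightarrow> real) topology.
           compact_space X \<and> Hausdorff_space X \<and>
           weight_eq X omega1 \<and>
           uniform_Eberlein_compact X \<and>
           Rosenthal_compact X \<and>
           first_countable X \<and>
           hereditarily paracompact_space X \<and>
           \<not> supercompact_space X"
proof -
  have "open {0 <..< (1 :: real)}" "{0 <..< (1 :: real)} \<noteq> {}"
    by auto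
  from Luzin_set[OF assms this] obtain L :: "real set" where L: "L \<subseteq> {0 <..< 1}" "uncountable L"
    "|L| \<le>o omega1" and Luzin: "\<And>M. meager M \<Longrightarrow> countable (L \<inter> M)"
    by auto
  interpret fibred L
    by unfold_locales (rule L(1))
  have "compact_space (top_of_set (fibspace L))"
    by (simp add: compact_space_subtopology compact_fibspace)
  moreover have "Hausdorff_space (euclidean :: (real \<Rightarrow> real) topology)"
    by (simp add: Hausdorff_space_product_topology flip: euclidean_product_topology)
  then have "Hausdorff_space (top_of_set (fibspace L))"
    by (rule Hausdorff_space_subtopology)
  ultimately show ?thesis
    using weight_fibspace[OF L(2,3)] uniform_Eberlein_compact_fibspace Rosenthal_compact_fibspace
      first_countable_fibspace hereditarily_paracompact_fibspace[OF Luzin] not_supercompact_fibspace[OF L(2) Luzin]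
    by (intro exI[of _ "top_of_set (fibspace L)"] conjI)
qed

end
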